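(* Let $F:\mathbb{R}^n\rightrightarrows\mathbb{R}^n$ satisfy assumptions (F) and (H), let $\mathcal{K}\subset\mathbb{R}^n$ be closed, let $\mathcal{T}$ be the associated minimum time function, and let $x_0\in\mathcal{R}\setminus\mathcal{K}$. Let $\bar x:[0,\mathcal{T}(x_0)]\to\mathbb{R}^n$ be an optimal trajectory for $x_0$ and let $\bar p:[0,\mathcal{T}(x_0)]\to\mathbb{R}^n$ be an absolutely continuous arc such that $(\bar x,\bar p)$ is a solution of the system $$\dot x(s)=\nabla_pH(x(s),p(s)),\qquad -\dot p(s)\in\partial_xH(x(s),p(s)),\qquad\text{a.e. } s\in[0,\mathcal{T}(x_0)],$$ satisfying $\bar x(0)=x_0$ and $(-\bar p(0),h(x_0,-\bar p(0)))\in N^P_{\mathrm{epi}(\mathcal{T})}(x_0,\mathcal{T}(x_0))$. Then for all $t\in[0,\mathcal{T}(x_0))$, $$(-\bar p(t),h(\bar x(t),-\bar p(t)))\in N^P_{\mathrm{epi}(\mathcal{T})}(\bar x(t),\mathcal{T}(\bar x(t))).$$ Moreover, $h(\bar x(t),-\bar p(t))=h(x_0,-\bar p(0))$ for all $t\in[0,\mathcal{T}(x_0)]$.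
   Context: Assumption (F) on a multifunction $F:\mathbb{R}^n\rightrightarrows\mathbb{R}^n$: (F1) $F(x)$ is nonempty, convex and compact for each $x\in\mathbb{R}^n$; (F2) for each compact $Q\subset\mathbb{R}^n$ there is $L>0$ with $F(x)\subset F(y)+L|y-x|\bar{\mathbb{B}}$ for all $x,y\in Q$, where $\bar{\mathbb{B}}$ is the closed unit ball; (F3) there is $\gamma>0$ with $\max\{|v|:v\in F(x)\}\le\gamma(1+|x|)$ for all $x\in\mathbb{R}^n$. Hamiltonians: $H(x,p)=\max_{v\in F(x)}\langle v,p\rangle$ and $h(x,\zeta)=\min_{v\in F(x)}\langle v,\zeta\rangle$. $\nabla_pH$ is the partial gradient in $p$; $\partial_xH(x,p)$ is Clarke's generalized gradient of $x\mapsto H(x,p)$, i.e. for a locally Lipschitz $f$, $\partial f(x)=\mathrm{co}\{v:\exists y_i\to x,\ f \text{ differentiable at } y_i,\ \nabla f(y_i)\to v\}$. Assumption (H): for every $r>0$, (H1) there exists $c\ge0$ so that for every $p\in\mathbb{S}^{n-1}$ (the unit sphere) the mapping $x\mapsto H(x,p)$ is semiconvex with semiconvexity constant $c$; (H2) $\nabla_pH(x,p)$ exists and is Lipschitz in $x$ on $B(0,r)$, uniformly for $p\in\mathbb{R}^n\setminus\{0\}$. Here a function $g$ on an open set $\Omega$ is semiconvex with constant $c$ if it is continuous and $g(x+k)+g(x-k)-2g(x)\ge-c|k|^2$ whenever $[x-k,x+k]\subset\Omega$. A trajectory of $F$ starting at $x$ is an absolutely continuous $x(\cdot)$ on $[0,T]$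 with $\dot x(t)\in F(x(t))$ for a.e. $t$ and $x(0)=x$. The minimum time function $\mathcal{T}:\mathbb{R}^n\to[0,+\infty]$ associated with the closed target $\mathcal{K}$ is $\mathcal{T}(x)=0$ if $x\in\mathcal{K}$, and otherwise $\mathcal{T}(x)=\inf\{T>0:\text{there is a trajectory } x(\cdot) \text{ of } F \text{ with } x(0)=x,\ x(T)\in\mathcal{K}\}$, with $\inf\emptyset=+\infty$. The controllable set is $\mathcal{R}=\{x:\mathcal{T}(x)<+\infty\}$. An optimal trajectory for $x_0\in\mathcal{R}$ is a trajectory $\bar x$ of $F$ on $[0,\mathcal{T}(x_0)]$ with $\bar x(0)=x_0$ and $\bar x(\mathcal{T}(x_0))\in\mathcal{K}$. For a closed set $E$ and $x\in E$, the proximal normal cone $N^P_E(x)$ is the set of $v$ for which there is $\sigma\ge0$ with $\langle v,y-x\rangle\le\sigma|y-x|^2$ for all $y\in E$. The epigraph is $\mathrm{epi}(\mathcal{T})=\{(x,\beta)\in\mathbb{R}^n\times\mathbb{R}:\mathcal{T}(x)<+\infty,\ \beta\ge\mathcal{T}(x)\}$. *)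

theory Defs
  imports "HOL-Analysis.Analysis"
begin

subsection \<open>Absolutely continuous arcs\<close>

text \<open>The usual epsilon-delta definition: \<open>D\<close> ranges over the finite families of nonoverlapping
  compact subintervals \<open>{Inf I..Sup I}\<close> of \<open>{a..b}\<close>.\<close>

definition abs_continuous :: "real \<Rightarrow> real \<Rightarrow> (real \<Rightarrow> 'a::real_normed_vector) \<Rightarrow> bool"
  where "abs_continuous a b f \<longleftrightarrow>
    (\<forall>\<epsilon>>0. \<exists>\<delta>>0. \<forall>D. D division_of \<Union>D \<and> \<Union>D \<subseteq> {a..b} \<and> (\<Sum>I\<in>D. Sup I - Inf I) < \<delta>
        \<longrightarrow> (\<Sum>I\<in>D. norm (f (Sup I) - f (Inf I))) < \<epsilon>)"

subsection \<open>Hamiltonians and the assumptions on the multifunction\<close>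

text \<open>For nonempty compact \<open>F x\<close> the supremum and the infimum below are attained, so they are the
  maximum and the minimum.\<close>

definition max_ham :: "('a::euclidean_space \<Rightarrow> 'a set) \<Rightarrow> 'a \<Rightarrow> 'a \<Rightarrow> real"
  where "max_ham F x p = (SUP v\<in>F x. v \<bullet> p)"

definition min_ham :: "('a::euclidean_space \<Rightarrow> 'a set) \<Rightarrow> 'a \<Rightarrow> 'a \<Rightarrow> real"
  where "min_ham F x \<zeta> = (INF v\<in>F x. v \<bullet> \<zeta>)"

definition assumption_F :: "('a::euclidean_space \<Rightarrow> 'a set) \<Rightarrow> bool"
  where "assumption_F F \<longleftrightarrow>
    (\<forall>x. F x \<noteq> {} \<and> convex (F x) \<and> compact (F x)) \<and>
    (\<forall>Q. compact Q \<longrightarrow>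
      (\<exists>L>0. \<forall>x\<in>Q. \<forall>y\<in>Q.
        F x \<subseteq> {w + (L * norm (y - x)) *\<^sub>R u | w u. w \<in> F y \<and> u \<in> cball 0 1})) \<and>
    (\<exists>\<gamma>>0. \<forall>x. \<forall>v\<in>F x. norm v \<le> \<gamma> * (1 + norm x))"

definition semiconvex_on :: "'a::real_normed_vector set \<Rightarrow> real \<Rightarrow> ('a \<Rightarrow> real) \<Rightarrow> bool"
  where "semiconvex_on \<Omega> c g \<longleftrightarrow>
    continuous_on \<Omega> g \<and>
    (\<forall>x k. closed_segment (x - k) (x + k) \<subseteq> \<Omega> \<longrightarrow>
      g (x + k) + g (x - k) - 2 * g x \<ge> - c * (norm k)\<^sup>2)"

text \<open>Semiconvexity in the first clause is required on each ball \<open>B(0,r)\<close>, with a constant that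
  may depend on \<open>r\<close>.\<close>

definition assumption_H :: "('a::euclidean_space \<Rightarrow> 'a set) \<Rightarrow> bool"
  where "assumption_H F \<longleftrightarrow>
    (\<forall>r>0.
      (\<exists>c\<ge>0. \<forall>p\<in>sphere 0 1. semiconvex_on (ball 0 r) c (\<lambda>x. max_ham F x p)) \<and>
      (\<exists>L. \<forall>p. p \<noteq> 0 \<longrightarrow>
        (\<exists>G. (\<forall>x\<in>ball 0 r. GDERIV (max_ham F x) p :> G x) \<and> L-lipschitz_on (ball 0 r) G)))"

definition clarke_gradient :: "('a::euclidean_space \<Rightarrow> real) \<Rightarrow> 'a \<Rightarrow> 'a set"
  where "clarke_gradient f x =
    convex hull {v. \<exists>y g. y \<longlonglongrightarrow> x \<and> (\<forall>i::nat. GDERIV f (y i) :> g i) \<and> g \<longlonglongrightarrow> v}"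

subsection \<open>Trajectories and the minimum time function\<close>

text \<open>Arcs on \<open>{0..T}\<close> are total functions on the reals whose values outside the interval are
  irrelevant; derivatives are therefore taken within \<open>{0..T}\<close>.\<close>

definition trajectory :: "('a::euclidean_space \<Rightarrow> 'a set) \<Rightarrow> real \<Rightarrow> 'a \<Rightarrow> (real \<Rightarrow> 'a) \<Rightarrow> bool"
  where "trajectory F T x0 x \<longleftrightarrow>
    abs_continuous 0 T x \<and>
    (AE t in lebesgue_on {0..T}. \<exists>v\<in>F (x t). (x has_vector_derivative v) (at t within {0..T})) \<and>
    x 0 = x0"

definition min_time :: "('a::euclidean_space \<Rightarrow> 'a set) \<Rightarrow> 'a set \<Rightarrow> 'a \<Rightarrow> ereal"
  where "min_time F K x =
    (if x \<in> K then 0 else Inf {ereal T | T. T > 0 \<and> (\<exists>\<xi>. trajectory F T x \<xi> \<and> \<xi> T \<in> K)})"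

definition controllable_set :: "('a::euclidean_space \<Rightarrow> 'a set) \<Rightarrow> 'a set \<Rightarrow> 'a set"
  where "controllable_set F K = {x. min_time F K x < \<infinity>}"

definition optimal_trajectory ::
    "('a::euclidean_space \<Rightarrow> 'a set) \<Rightarrow> 'a set \<Rightarrow> 'a \<Rightarrow> (real \<Rightarrow> 'a) \<Rightarrow> bool"
  where "optimal_trajectory F K x0 x \<longleftrightarrow>
    (let T = real_of_ereal (min_time F K x0) in trajectory F T x0 x \<and> x T \<in> K)"

text \<open>The gradient in \<open>p\<close> is only guaranteed to exist for nonzero \<open>p\<close>; its existence at \<open>p s\<close> for
  almost every \<open>s\<close> is part of being a solution.\<close>

definition hamiltonian_solution ::
    "('a::euclidean_space \<Rightarrow> 'a set) \<Rightarrow> real \<Rightarrow> (real \<Rightarrow> 'a) \<Rightarrow> (real \<Rightarrow> 'a) \<Rightarrow> bool"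
  where "hamiltonian_solution F T x p \<longleftrightarrow>
    (AE s in lebesgue_on {0..T}.
      \<exists>x' p'. (x has_vector_derivative x') (at s within {0..T}) \<and>
              (p has_vector_derivative p') (at s within {0..T}) \<and>
              GDERIV (max_ham F (x s)) (p s) :> x' \<and>
              - p' \<in> clarke_gradient (\<lambda>z. max_ham F z (p s)) (x s))"

subsection \<open>Proximal normals and epigraph\<close>

text \<open>The cone is empty at points outside \<open>E\<close>.\<close>

definition proximal_normal_cone :: "'a::real_inner set \<Rightarrow> 'a \<Rightarrow> 'a set"
  where "proximal_normal_cone E x =
    {v. x \<in> E \<and> (\<exists>\<sigma>\<ge>0. \<forall>y\<in>E. v \<bullet> (y - x) \<le> \<sigma> * (norm (y - x))\<^sup>2)}"

definition epi :: "('a \<Rightarrow> ereal) \<Rightarrow> ('a \<times> real) set"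
  where "epi f = {(x, \<beta>). f x < \<infinity> \<and> f x \<le> ereal \<beta>}"

end

theory Submission
  imports Defs
begin

text \<open>Along the arc \<open>H(x, p)\<close> has nonnegative lower derivatives to the right and nonpositive upper
  derivatives to the left almost everywhere, by semiconvexity in \<open>x\<close> and convexity in \<open>p\<close>; being Lipschitz it is
  constant, and \<open>h(x, -p) = -H(x, p)\<close>. To carry the normal from \<open>x(t\<^sub>1)\<close> to \<open>x(t\<^sub>2)\<close> with \<open>t\<^sub>2 - t\<^sub>1\<close> small, take
  \<open>z\<close> near \<open>x(t\<^sub>2)\<close> and solve \<open>y' = \<nabla>\<^sub>pH(y, p)\<close> backward from \<open>y(t\<^sub>2) = z\<close>. This is a trajectory of \<open>F\<close>, so
  the minimum time at \<open>y(t\<^sub>1)\<close> exceeds that at \<open>z\<close> by at most \<open>t\<^sub>2 - t\<^sub>1\<close>, while \<open>p \<bullet> (y - x)\<close> decreases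
  between \<open>t\<^sub>1\<close> and \<open>t\<^sub>2\<close> by at most a multiple of \<open>|z - x(t\<^sub>2)|\<^sup>2\<close>. Hence the proximal inequality at
  \<open>(y(t\<^sub>1), \<beta> + t\<^sub>2 - t\<^sub>1)\<close> gives the one at \<open>(z, \<beta>)\<close>. If \<open>p\<close> vanishes somewhere it vanishes identically and
  there is nothing to prove.\<close>

section \<open>Absolutely continuous and Lipschitz arcs\<close>

text \<open>\<open>H\<close> is only semiconvex in \<open>x\<close>, so every estimate along an arc
  is one-sided. Two identities make this enough. With \<open>x' = \<nabla>\<^sub>pH\<close> and
  \<open>-p'\<close> in the Clarke gradient, the first-order part
  \<open>x' \<bullet> p' - p' \<bullet> x'\<close> of an increment of \<open>H(x, p)\<close>
  cancels, and what remains is of second order. For the normals,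
  \<open>p \<bullet> \<nabla>\<^sub>pH(y, p) = H(y, p)\<close> turns a difference of velocities into
  a difference of values of \<open>H\<close>, to which semiconvexity applies; no linearised flow
  appears. The gradient in \<open>p\<close> is available only for nonzero \<open>p\<close>, and the
  field \<open>\<nabla>\<^sub>pH(y, p(s))\<close> is continuous in \<open>s\<close> only there;
  hence the separate treatment of a vanishing adjoint arc. The time step is short because both the
  contraction that produces \<open>y\<close> and the bound on \<open>|y - x|\<close> ask for
  \<open>L (t\<^sub>2 - t\<^sub>1) \<le> 1/2\<close>, with \<open>L\<close> the Lipschitz constant
  of the field. This step length depends neither on the base point nor on the constant in the
  proximal inequality, so finitely many steps cover the interval although that constant grows at
  each of them.\<close>

lemma AE_lebesgue_on_iff_negligible:
  assumes "S \<in> sets lebesgue"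
  shows "(AE s in lebesgue_on S. P s) \<longleftrightarrow> (\<exists>N. negligible N \<and> (\<forall>s\<in>S - N. P s))"
proof -
  have "(AE s in lebesgue_on S. P s) \<longleftrightarrow> (AE s in lebesgue. s \<in> S \<longrightarrow> P s)"
    using assms by (simp add: AE_restrict_space_iff)
  also have "\<dots> \<longleftrightarrow> (\<exists>N. negligible N \<and> (\<forall>s\<in>S - N. P s))"
    unfolding eventually_ae_filter_negligible by blast
  finally show ?thesis .
qed

lemma negligible_open_superset:
  assumes "negligible N" "e > 0"
  obtains U where "open U" "N \<subseteq> U" "U \<in> lmeasurable" "measure lebesgue U < e"
proof -
  have N: "N \<in> null_sets lebesgue"
    using assms(1) by (simp add: negligible_iff_null_sets)
  obtain U where U: "open U" "N \<subseteq> U" "U - N \<in> lmeasurable"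
      "emeasure lebesgue (U - N) < ennreal e"
    using sets_lebesgue_outer_open[of N e] N assms(2) by blast
  have meas: "U \<in> lmeasurable"
    using U(2,3) assms(1) by (metis Un_Diff_cancel2 fmeasurable.Un negligible_iff_measure sup.absorb1)
  have "measure lebesgue U = measure lebesgue (U - N)"
    using measure_Diff_null_set[OF _ N, of U] meas by simp
  also have "\<dots> < e"
    using U(4) assms(2) by (simp add: U(3) emeasure_eq_measure2 ennreal_less_iff)
  finally show thesis
    using that U(1,2) meas by blast
qed

section \<open>From absolute continuity to Lipschitz bounds\<close>

lemma abs_continuous_imp_continuous_on:
  assumes "abs_continuous a b f"
  shows "continuous_on {a..b} f"
  unfolding continuous_on_iff
proof (intro ballI allI impI)
  fix s and e :: real
  assume s: "s \<in> {a..b}" and "0 < e"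
  then obtain d where d: "d > 0" and D: "\<And>D. D division_of \<Union>D \<Longrightarrow> \<Union>D \<subseteq> {a..b}
      \<Longrightarrow> (\<Sum>I\<in>D. Sup I - Inf I) < d \<Longrightarrow> (\<Sum>I\<in>D. norm (f (Sup I) - f (Inf I))) < e"
    using assms unfolding abs_continuous_def by meson
  have *: "norm (f v - f u) < e" if "u \<in> {a..b}" "v \<in> {a..b}" "u \<le> v" "v - u < d" for u v
    using D[of "{{u..v}}"] that division_of_self[of u v] by simp
  show "\<exists>d>0. \<forall>s'\<in>{a..b}. dist s' s < d \<longrightarrow> dist (f s') (f s) < e"
  proof (intro exI conjI ballI impI)
    fix s' assume "s' \<in> {a..b}" "dist s' s < d"
    then show "dist (f s') (f s) < e"
      using *[of s s'] *[of s' s] s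
      by (cases "s \<le> s'") (auto simp: dist_norm norm_minus_commute)
  qed (fact d)
qed

lemma lipschitz_on_imp_abs_continuous:
  assumes "M-lipschitz_on {a..b} f"
  shows "abs_continuous a b f"
  unfolding abs_continuous_def
proof (intro allI impI)
  fix e :: real assume "0 < e"
  have M: "M \<ge> 0" using assms by (rule lipschitz_on_nonneg)
  have "(\<Sum>I\<in>D. norm (f (Sup I) - f (Inf I))) < e"
    if D: "D division_of \<Union>D" "\<Union>D \<subseteq> {a..b}" and len: "(\<Sum>I\<in>D. Sup I - Inf I) < e / (M + 1)" for D
  proof -
    have "norm (f (Sup I) - f (Inf I)) \<le> M * (Sup I - Inf I)" if I: "I \<in> D" for I
    proof -
      obtain u v where uv: "I = {u..v}" "u \<le> v"
        using division_ofD(3,4)[OF D(1) I] by (metis atLeastatMost_empty_iff2 box_real(2))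
      then have "{u..v} \<subseteq> {a..b}"
        using D(2) I by blast
      then have "u \<in> {a..b}" "v \<in> {a..b}"
        using uv(2) by auto
      then show ?thesis
        using lipschitz_onD[OF assms, of v u] uv by (simp add: dist_norm)
    qed
    then have "(\<Sum>I\<in>D. norm (f (Sup I) - f (Inf I))) \<le> M * (\<Sum>I\<in>D. Sup I - Inf I)"
      by (simp add: sum_distrib_left sum_mono)
    also have "\<dots> \<le> M * (e / (M + 1))"
      using len M by (intro mult_left_mono) auto
    also have "\<dots> < e"
      using M \<open>0 < e\<close> by (simp add: divide_simps)
    finally show ?thesis .
  qed
  then show "\<exists>\<delta>>0. \<forall>D. D division_of \<Union>D \<and> \<Union>D \<subseteq> {a..b} \<and> (\<Sum>I\<in>D. Sup I - Inf I) < \<delta>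
        \<longrightarrow> (\<Sum>I\<in>D. norm (f (Sup I) - f (Inf I))) < e"
    using M \<open>0 < e\<close> by (intro exI[of _ "e / (M + 1)"]) auto
qed

lemma abs_continuous_subinterval:
  assumes "abs_continuous a b f" "{c..d} \<subseteq> {a..b}"
  shows "abs_continuous c d f"
  using assms unfolding abs_continuous_def by (meson order_trans)

text \<open>Straddling a tag \<open>s\<close> outside \<open>N\<close>, an increment of \<open>f\<close> is controlled by the derivative at \<open>s\<close>;
  the intervals tagged in \<open>N\<close> lie in an open set of small measure, where absolute continuity applies.\<close>

lemma abs_continuous_bounded_derivative:
  assumes ac: "abs_continuous a b f" and "a \<le> b" "0 \<le> M" and N: "negligible N"
    and der: "\<And>s. s \<in> {a..b} - N \<Longrightarrow> \<exists>d. norm d \<le> M \<and> (f has_vector_derivative d) (at s within {a..b})"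
  shows "norm (f b - f a) \<le> M * (b - a)"
proof (rule field_le_epsilon)
  fix e0 :: real assume "0 < e0"
  \<comment> \<open>Intervals with good tags cost an error \<open>e * (b - a)\<close> in total, the
    remaining ones at most \<open>e\<close>; together this is \<open>e0\<close>.\<close>
  define e where "e = e0 / (b - a + 1)"
  have e: "e > 0"
    using \<open>0 < e0\<close> \<open>a \<le> b\<close> by (simp add: e_def)
  have "e * (b - a + 1) = e0"
    using \<open>a \<le> b\<close> by (simp add: e_def)
  then have e0: "e * (b - a) + e = e0"
    by (simp add: algebra_simps)
  obtain d where d: "d > 0" and D: "\<And>D. D division_of \<Union>D \<Longrightarrow> \<Union>D \<subseteq> {a..b}
      \<Longrightarrow> (\<Sum>I\<in>D. Sup I - Inf I) < d \<Longrightarrow> (\<Sum>I\<in>D. norm (f (Sup I) - f (Inf I))) < e"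
    using ac e unfolding abs_continuous_def by meson
  obtain U where U: "open U" "N \<subseteq> U" "U \<in> lmeasurable" "measure lebesgue U < d"
    using negligible_open_superset[OF N d] .
  have "\<exists>r>0. (s \<in> N \<longrightarrow> ball s r \<subseteq> U) \<and> (s \<in> {a..b} - N \<longrightarrow>
      (\<forall>v\<in>{a..b} \<inter> ball s r. norm (f v - f s) \<le> (M + e) * \<bar>v - s\<bar>))" for s
  proof (cases "s \<in> N")
    case True
    then show ?thesis
      using U(1,2) open_contains_ball by (metis Diff_iff subsetD)
  next
    case False
    show ?thesis
    proof (cases "s \<in> {a..b}")
      case True
      then obtain c where c: "norm c \<le> M" "(f has_vector_derivative c) (at s within {a..b})"
        using der False by blast
      then obtain r where r: "r > 0" and bd: "\<And>v. v \<in> {a..b} \<Longrightarrow> norm (v - s) < r \<Longrightarrow>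
          norm (f v - f s - (v - s) *\<^sub>R c) \<le> e * norm (v - s)"
        unfolding has_vector_derivative_def has_derivative_within_alt using e by metis
      have "norm (f v - f s) \<le> (M + e) * \<bar>v - s\<bar>" if "v \<in> {a..b}" "v \<in> ball s r" for v
      proof -
        have "norm (f v - f s) \<le> norm (f v - f s - (v - s) *\<^sub>R c) + norm ((v - s) *\<^sub>R c)"
          by (metis diff_add_cancel norm_triangle_ineq)
        also have "\<dots> \<le> e * \<bar>v - s\<bar> + \<bar>v - s\<bar> * M"
          using bd[of v] that c(1) by (intro add_mono) (auto simp: dist_real_def intro: mult_left_mono)
        finally show ?thesis by (simp add: algebra_simps)
      qed
      with r show ?thesis using False by blast
    qed (use False in \<open>auto intro: exI[of _ 1]\<close>)
  qed
  then obtain r where r: "\<And>s. r s > 0" "\<And>s. s \<in> N \<Longrightarrow> ball s (r s) \<subseteq> U"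
      "\<And>s v. s \<in> {a..b} - N \<Longrightarrow> v \<in> {a..b} \<inter> ball s (r s) \<Longrightarrow>
        norm (f v - f s) \<le> (M + e) * \<bar>v - s\<bar>"
    by metis
  have "gauge (\<lambda>s. ball s (r s))"
    using r(1) by (simp add: gauge_def)
  then obtain p where p: "p tagged_division_of {a..b}" and fine: "(\<lambda>s. ball s (r s)) fine p"
    using fine_division_exists_real by blast
  have finp: "finite p" using p by blast
  define q where "q = {(s, I) \<in> p. s \<in> N}"
  have qp: "q \<subseteq> p" by (auto simp: q_def)
  have I: "\<exists>u v. I = {u..v} \<and> u \<le> v \<and> s \<in> {u..v} \<and> {u..v} \<subseteq> {a..b} \<and> {u..v} \<subseteq> ball s (r s)"
    if sI: "(s, I) \<in> p" for s I
    using tagged_division_ofD(2-4)[OF p sI] fineD[OF fine sI]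
    by (metis atLeastatMost_empty_iff2 box_real(2) empty_iff)
  have good: "norm (f (Sup I) - f (Inf I)) \<le> (M + e) * measure lborel I" if sI: "(s, I) \<in> p - q" for s I
  proof -
    obtain u v where uv: "I = {u..v}" "u \<le> v" "s \<in> {u..v}" "{u..v} \<subseteq> {a..b}" "{u..v} \<subseteq> ball s (r s)"
      using I sI by blast
    have s: "s \<in> {a..b} - N" using sI uv by (auto simp: q_def)
    have "norm (f v - f u) \<le> norm (f v - f s) + norm (f u - f s)"
      by (metis norm_triangle_ineq4 add.commute diff_diff_eq2 diff_add_cancel)
    also have "\<dots> \<le> (M + e) * \<bar>v - s\<bar> + (M + e) * \<bar>u - s\<bar>"
    proof (intro add_mono r(3)[OF s])
      have "u \<in> {u..v}" "v \<in> {u..v}" using uv(2) by auto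
      then show "v \<in> {a..b} \<inter> ball s (r s)" "u \<in> {a..b} \<inter> ball s (r s)"
        using subsetD[OF uv(4)] subsetD[OF uv(5)] by auto
    qed
    also have "\<dots> = (M + e) * (v - u)"
      using uv by (auto simp: algebra_simps)
    finally show ?thesis using uv by simp
  qed
  \<comment> \<open>Two tags may share an interval only if it is degenerate, and then its increment
    is zero. The value 0 on \<open>{}\<close> lets a sum over tagged pairs become a sum over
    intervals, where empty boxes are also tested and \<open>Sup {}\<close>, \<open>Inf {}\<close>
    carry no information.\<close>
  define \<phi> where "\<phi> = (\<lambda>I. if I = {} then 0 else norm (f (Sup I) - f (Inf I)))"
  have q: "q tagged_partial_division_of {a..b}"
    using p qp by (meson tagged_division_of_def tagged_partial_division_subset)
  have div: "snd ` q division_of \<Union>(snd ` q)"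
    by (rule partial_division_of_tagged_division[OF q])
  have sub: "\<Union>(snd ` q) \<subseteq> {a..b}" "\<Union>(snd ` q) \<subseteq> U"
    using I r(2) qp by (fastforce simp: q_def)+
  have "(\<Sum>I\<in>snd ` q. Sup I - Inf I) = sum (measure lebesgue) (snd ` q)"
  proof (rule sum.cong)
    fix J assume "J \<in> snd ` q"
    then obtain s where "(s, J) \<in> p" using qp by auto
    then show "Sup J - Inf J = measure lebesgue J" using I[of s J] by auto
  qed simp
  also have "\<dots> = measure lebesgue (\<Union>(snd ` q))"
    using content_division[OF div] by simp
  also have "\<dots> \<le> measure lebesgue U"
    using sub(2) U(3) div by (intro measure_mono_fmeasurable) (auto intro: lmeasurable_division fmeasurableD)
  finally have small: "(\<Sum>I\<in>snd ` q. norm (f (Sup I) - f (Inf I))) < e"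
    using D[OF div sub(1)] U(4) by linarith
  have ne: "I \<noteq> {}" if "(s, I) \<in> p" for s I
    using I[OF that] by auto
  have "(\<Sum>(s, I)\<in>q. norm (f (Sup I) - f (Inf I))) = (\<Sum>(s, I)\<in>q. \<phi> I)"
    using ne qp by (intro sum.cong) (auto simp: \<phi>_def)
  also have "\<dots> = (\<Sum>I\<in>snd ` q. \<phi> I)"
    by (rule sum.over_tagged_division_lemma[OF tagged_partial_division_of_Union_self[OF q]])
      (auto simp: \<phi>_def box_eq_empty)
  also have "\<dots> = (\<Sum>I\<in>snd ` q. norm (f (Sup I) - f (Inf I)))"
    using ne qp by (intro sum.cong) (auto simp: \<phi>_def)
  finally have bad: "(\<Sum>(s, I)\<in>q. norm (f (Sup I) - f (Inf I))) < e"
    using small by simp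
  have "norm (f b - f a) = norm (\<Sum>(s, I)\<in>p. f (Sup I) - f (Inf I))"
    using additive_tagged_division_1[OF \<open>a \<le> b\<close> p, of f] by simp
  also have "\<dots> \<le> (\<Sum>(s, I)\<in>p. norm (f (Sup I) - f (Inf I)))"
    by (rule order_trans[OF norm_sum]) (simp add: case_prod_unfold)
  also have "\<dots> = (\<Sum>(s, I)\<in>p - q. norm (f (Sup I) - f (Inf I)))
      + (\<Sum>(s, I)\<in>q. norm (f (Sup I) - f (Inf I)))"
    by (rule sum.subset_diff[OF qp finp])
  also have "\<dots> \<le> (\<Sum>(s, I)\<in>p - q. (M + e) * measure lborel I) + e"
    using good bad by (intro add_mono sum_mono) auto
  also have "(\<Sum>(s, I)\<in>p - q. (M + e) * measure lborel I) \<le> (\<Sum>(s, I)\<in>p. (M + e) * measure lborel I)"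
    using \<open>0 \<le> M\<close> e by (intro sum_mono2 finp) auto
  also have "\<dots> = (M + e) * (\<Sum>(s, I)\<in>p. measure lborel I)"
    by (simp add: sum_distrib_left case_prod_unfold)
  also have "(\<Sum>(s, I)\<in>p. measure lborel I) = b - a"
    using additive_content_tagged_division[of p a b] p \<open>a \<le> b\<close> by simp
  finally show "norm (f b - f a) \<le> M * (b - a) + e0"
    using e0 by (simp add: algebra_simps)
qed

text \<open>All arcs used below become Lipschitz through this lemma: trajectories by linear growth
  of \<open>F\<close> along a bounded range, the adjoint arc by \<open>|p'| \<le> L |p|\<close>. The
  monotonicity criteria that follow need a Lipschitz constant.\<close>

lemma abs_continuous_imp_lipschitz_on:
  assumes ac: "abs_continuous a b f" and "0 \<le> M" and N: "negligible N"
    and der: "\<And>s. s \<in> {a..b} - N \<Longrightarrow> \<exists>d. norm d \<le> M \<and> (f has_vector_derivative d) (at s within {a..b})"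
  shows "M-lipschitz_on {a..b} f"
proof -
  have *: "norm (f v - f u) \<le> M * (v - u)" if "u \<in> {a..b}" "v \<in> {a..b}" "u \<le> v" for u v
  proof (rule abs_continuous_bounded_derivative[OF _ that(3) \<open>0 \<le> M\<close> N])
    have sub: "{u..v} \<subseteq> {a..b}" using that by auto
    then show "abs_continuous u v f" by (rule abs_continuous_subinterval[OF ac])
    fix s assume "s \<in> {u..v} - N"
    then show "\<exists>d. norm d \<le> M \<and> (f has_vector_derivative d) (at s within {u..v})"
      using der[of s] sub has_vector_derivative_within_subset by blast
  qed
  show ?thesis
  proof (rule lipschitz_onI)
    fix u v assume "u \<in> {a..b}" "v \<in> {a..b}"
    then show "dist (f u) (f v) \<le> M * dist u v"
      using *[of u v] *[of v u] by (cases "u \<le> v") (auto simp: dist_norm norm_minus_commute)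
  qed (fact \<open>0 \<le> M\<close>)
qed

text \<open>Adding \<open>\<epsilon> s + M |U \<inter> [a, s]|\<close>, for a small open neighbourhood \<open>U\<close> of the exceptional set, makes
  the right lower derivative nonnegative at every point.\<close>

lemma lipschitz_on_right_dini_nonneg:
  fixes f :: "real \<Rightarrow> real"
  assumes lip: "M-lipschitz_on {a..b} f" and "a \<le> b" and N: "negligible N"
    and dini: "\<And>s e. s \<in> {a..b} - N \<Longrightarrow> e > 0 \<Longrightarrow>
      \<exists>d>0. \<forall>u\<in>{a..b}. s < u \<and> u < s + d \<longrightarrow> f u - f s \<ge> - e * (u - s)"
  shows "f a \<le> f b"
proof (rule field_le_epsilon)
  fix e0 :: real assume "0 < e0"
  have M: "M \<ge> 0" using lip by (rule lipschitz_on_nonneg)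
  \<comment> \<open>The linear perturbation contributes at most \<open>e1 * (b - a)\<close> and the
    measure term at most \<open>M * e1\<close>; both fit into \<open>e0\<close>.\<close>
  define e1 where "e1 = e0 / (b - a + M + 1)"
  have e: "e1 > 0"
    using \<open>0 < e0\<close> \<open>a \<le> b\<close> M by (simp add: e1_def)
  have "e1 * (b - a + M + 1) = e0"
    using \<open>a \<le> b\<close> M by (simp add: e1_def)
  then have e0: "e1 * (b - a) + M * e1 \<le> e0"
    using e by (simp add: algebra_simps)
  obtain U where U: "open U" "N \<subseteq> U" "U \<in> lmeasurable" "measure lebesgue U < e1"
    using negligible_open_superset[OF N e] .
  define m where "m = (\<lambda>s. measure lebesgue (U \<inter> {a..s}))"
  have meas: "U \<inter> {c..d} \<in> lmeasurable" for c d :: real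
    using fmeasurable.Int[OF U(3), of "{c..d}"] by simp
  have m_mono: "m s \<le> m u" if "s \<le> u" for s u
    unfolding m_def by (rule measure_mono_fmeasurable[OF _ fmeasurableD[OF meas] meas]) (use that in auto)
  have m_inc: "m u \<le> m s + (u - s)" if "s \<le> u" for s u
  proof -
    have "m u \<le> measure lebesgue ((U \<inter> {a..s}) \<union> {s..u})"
      unfolding m_def by (rule measure_mono_fmeasurable[OF _ fmeasurableD[OF meas]])
        (use meas in auto)
    also have "\<dots> \<le> measure lebesgue (U \<inter> {a..s}) + measure lebesgue {s..u}"
      by (rule measure_Un_le) (use meas in auto)
    finally show ?thesis using that by (simp add: m_def)
  qed
  have m_jump: "m u \<ge> m s + (u - s)" if "a \<le> s" "s \<le> u" "{s..u} \<subseteq> U" for s u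
  proof -
    have "AE t in lebesgue. t \<notin> U \<inter> {a..s} \<or> t \<notin> {s..u}"
      unfolding eventually_ae_filter_negligible by (rule exI[of _ "{s}"]) auto
    then have "m s + (u - s) = measure lebesgue ((U \<inter> {a..s}) \<union> {s..u})"
      using measure_Un_AE[OF _ meas, of a s "{s..u}"] that by (simp add: m_def)
    also have "\<dots> \<le> m u"
      unfolding m_def by (rule measure_mono_fmeasurable[OF _ _ meas])
        (use that fmeasurableD[OF meas] in auto)
    finally show ?thesis .
  qed
  have m_cont: "continuous_on {a..b} m"
  proof (rule lipschitz_on_continuous_on[of 1])
    show "1-lipschitz_on {a..b} m"
    proof (rule lipschitz_onI)
      fix u v
      show "dist (m u) (m v) \<le> 1 * dist u v"
        using m_mono[of u v] m_mono[of v u] m_inc[of u v] m_inc[of v u]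
        by (cases "u \<le> v") (auto simp: dist_real_def)
    qed simp
  qed
  define g where "g = (\<lambda>s. f s + e1 * (s - a) + M * m s)"
  have g_cont: "continuous_on {a..b} g"
    unfolding g_def using lipschitz_on_continuous_on[OF lip] m_cont by (intro continuous_intros)
  \<comment> \<open>At a point of \<open>N\<close> the measure term grows with slope
    \<open>M\<close> and offsets the worst Lipschitz descent of \<open>f\<close>; elsewhere the
    linear term absorbs the error in \<open>dini\<close>.\<close>
  have step: "\<exists>d>0. \<forall>u\<in>{a..b}. s < u \<and> u < s + d \<longrightarrow> g u \<ge> g s" if s: "s \<in> {a..b}" for s
  proof (cases "s \<in> N")
    case True
    then obtain r where r: "r > 0" "ball s r \<subseteq> U"
      using U(1,2) open_contains_ball by (metis subsetD)
    show ?thesis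
    proof (intro exI[of _ r] conjI ballI impI)
      fix u assume u: "u \<in> {a..b}" "s < u \<and> u < s + r"
      then have "{s..u} \<subseteq> ball s r" by (auto simp: dist_real_def)
      then have "M * m u \<ge> M * (m s + (u - s))"
        using m_jump[of s u] s u r M by (intro mult_left_mono) auto
      moreover have "f u \<ge> f s - M * (u - s)"
        using lipschitz_onD[OF lip, of u s] s u by (auto simp: dist_real_def)
      moreover have "e1 * (u - s) \<ge> 0" using e u by simp
      ultimately show "g s \<le> g u" by (simp add: g_def algebra_simps)
    qed (fact r)
  next
    case False
    then obtain d where d: "d > 0" "\<And>u. u \<in> {a..b} \<Longrightarrow> s < u \<and> u < s + d \<Longrightarrow> f u - f s \<ge> - e1 * (u - s)"
      using dini[of s e1] e s by blast
    show ?thesis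
    proof (intro exI[of _ d] conjI ballI impI)
      fix u assume u: "u \<in> {a..b}" "s < u \<and> u < s + d"
      then have "M * m s \<le> M * m u"
        using m_mono[of s u] M by (intro mult_left_mono) auto
      then show "g s \<le> g u" using d(2)[OF u] by (simp add: g_def algebra_simps)
    qed (fact d)
  qed
  define S where "S = {s \<in> {a..b}. g s \<ge> g a}"
  \<comment> \<open>Continuity induction: \<open>A\<close> is the set of endpoints up to which
    \<open>g\<close> stays above \<open>g a\<close>. Its supremum \<open>c\<close> is itself a good
    point since \<open>S\<close> is closed, and \<open>step\<close> would push beyond
    \<open>c\<close> if \<open>c < b\<close>.\<close>
  define A where "A = {s \<in> {a..b}. {a..s} \<subseteq> S}"
  define c where "c = Sup A"
  have aA: "a \<in> A" using \<open>a \<le> b\<close> by (auto simp: A_def S_def)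
  have bdd: "bdd_above A" by (auto simp: A_def)
  have c: "c \<in> {a..b}"
  proof -
    have "a \<le> c" unfolding c_def by (rule cSup_upper[OF aA bdd])
    moreover have "c \<le> b" unfolding c_def by (rule cSup_least) (use aA in \<open>auto simp: A_def\<close>)
    ultimately show ?thesis by simp
  qed
  have below: "u \<in> S" if "a \<le> u" "u < c" for u
  proof -
    have "\<exists>s\<in>A. u < s"
      using that(2) unfolding c_def by (rule less_cSupD[rotated]) (use aA in blast)
    then obtain s where "s \<in> A" "u < s" ..
    then show ?thesis using that by (auto simp: A_def)
  qed
  have "c \<in> S"
  proof (cases "c = a")
    case False
    have "closed S"
    proof -
      have "S = {a..b} \<inter> g -` {g a..}" by (auto simp: S_def)
      then show ?thesis
        using continuous_closed_preimage[OF g_cont] by simp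
    qed
    moreover have "c \<in> closure {a..<c}"
      using False c by (simp add: closure_atLeastLessThan)
    moreover have "{a..<c} \<subseteq> S" using below by auto
    ultimately show ?thesis using closure_minimal[of "{a..<c}" S] by blast
  qed (use aA in \<open>auto simp: A_def\<close>)
  have "c = b"
  proof (rule ccontr)
    assume "c \<noteq> b"
    then have "c < b" using c by auto
    obtain d where d: "d > 0" "\<And>u. u \<in> {a..b} \<Longrightarrow> c < u \<and> u < c + d \<Longrightarrow> g u \<ge> g c"
      using step[OF c] by blast
    define u where "u = min b (c + d / 2)"
    have u: "c < u" "u \<le> b" "u < c + d" using d(1) \<open>c < b\<close> by (auto simp: u_def)
    have "{a..u} \<subseteq> S"
    proof
      fix s assume s: "s \<in> {a..u}"
      show "s \<in> S"
      proof (cases "s \<le> c")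
        case True
        then show ?thesis using below[of s] \<open>c \<in> S\<close> s by (cases "s = c") auto
      next
        case False
        then have "g c \<le> g s" using d(2)[of s] s u c by auto
        then show ?thesis using \<open>c \<in> S\<close> s u by (auto simp: S_def)
      qed
    qed
    then have "u \<in> A" using u c by (auto simp: A_def)
    then show False using cSup_upper[OF _ bdd, of u] u by (simp add: c_def)
  qed
  then have "g a \<le> g b" using \<open>c \<in> S\<close> by (simp add: S_def)
  moreover have "m b \<le> e1"
  proof -
    have "m b \<le> measure lebesgue U"
      unfolding m_def by (rule measure_mono_fmeasurable[OF _ fmeasurableD[OF meas] U(3)]) auto
    then show ?thesis using U(4) by simp
  qed
  then have "M * m b \<le> M * e1" using M by (rule mult_left_mono)
  moreover have "M * m a \<ge> 0" using M by (simp add: m_def)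
  ultimately show "f a \<le> f b + e0" using e0 by (simp add: g_def)
qed

lemma lipschitz_on_derivative_nonneg:
  fixes f :: "real \<Rightarrow> real"
  assumes lip: "M-lipschitz_on {a..b} f" and "a \<le> b" and N: "negligible N"
    and der: "\<And>s. s \<in> {a..b} - N \<Longrightarrow> \<exists>d\<ge>0. (f has_real_derivative d) (at s within {a..b})"
  shows "f a \<le> f b"
proof (rule lipschitz_on_right_dini_nonneg[OF lip \<open>a \<le> b\<close> N])
  fix s e :: real assume s: "s \<in> {a..b} - N" and "e > 0"
  obtain c where c: "c \<ge> 0" "(f has_real_derivative c) (at s within {a..b})"
    using der[OF s] by blast
  then obtain d where d: "d > 0" "\<And>u. u \<in> {a..b} \<Longrightarrow> norm (u - s) < d \<Longrightarrow>
      norm (f u - f s - c * (u - s)) \<le> e * norm (u - s)"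
    unfolding has_field_derivative_def has_derivative_within_alt using \<open>e > 0\<close> by metis
  have "f u - f s \<ge> - e * (u - s)" if "u \<in> {a..b}" "s < u" "u < s + d" for u
  proof -
    have "c * (u - s) \<ge> 0" using c that by simp
    then show ?thesis using d(2)[of u] that by (simp add: abs_le_iff)
  qed
  then show "\<exists>d>0. \<forall>u\<in>{a..b}. s < u \<and> u < s + d \<longrightarrow> f u - f s \<ge> - e * (u - s)"
    using d(1) by blast
qed

text \<open>Reflecting time turns left increments into right increments and keeps null sets null, so
  the previous criterion applies on \<open>{- b..- a}\<close>.\<close>

lemma lipschitz_on_left_dini_nonpos:
  fixes f :: "real \<Rightarrow> real"
  assumes lip: "M-lipschitz_on {a..b} f" and "a \<le> b" and N: "negligible N"
    and dini: "\<And>s e. s \<in> {a..b} - N \<Longrightarrow> e > 0 \<Longrightarrow>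
      \<exists>d>0. \<forall>u\<in>{a..b}. s - d < u \<and> u < s \<longrightarrow> f u - f s \<ge> - e * (s - u)"
  shows "f b \<le> f a"
proof -
  have "f (- (- b)) \<le> f (- (- a))"
  proof (rule lipschitz_on_right_dini_nonneg[where f = "\<lambda>s. f (- s)" and a = "- b" and b = "- a"
        and N = "uminus ` N"])
    show "M-lipschitz_on {- b..- a} (\<lambda>s. f (- s))"
    proof (rule lipschitz_onI)
      fix u v :: real assume "u \<in> {- b..- a}" "v \<in> {- b..- a}"
      then show "dist (f (- u)) (f (- v)) \<le> M * dist u v"
        using lipschitz_onD[OF lip, of "- u" "- v"] by (auto simp: dist_real_def abs_minus_commute)
    qed (rule lipschitz_on_nonneg[OF lip])
    show "negligible (uminus ` N)"
      by (rule negligible_differentiable_image_negligible[OF _ N]) (auto intro!: derivative_intros)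
    fix s e :: real assume s: "s \<in> {- b..- a} - uminus ` N" and "e > 0"
    then have "- s \<in> {a..b} - N" by force
    then obtain d where d: "d > 0" "\<And>u. u \<in> {a..b} \<Longrightarrow> - s - d < u \<and> u < - s \<Longrightarrow>
        f u - f (- s) \<ge> - e * (- s - u)"
      using dini \<open>e > 0\<close> by blast
    have "f (- u) - f (- s) \<ge> - e * (u - s)" if "u \<in> {- b..- a}" "s < u \<and> u < s + d" for u
      using d(2)[of "- u"] that by auto
    with d(1) show "\<exists>d>0. \<forall>u\<in>{- b..- a}. s < u \<and> u < s + d \<longrightarrow> f (- u) - f (- s) \<ge> - e * (u - s)"
      by blast
  qed (use \<open>a \<le> b\<close> in simp)
  then show ?thesis by simp
qed

text \<open>A short-interval substitute for Gronwall's inequality. At a point \<open>u\<close> where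
  \<open>|w|\<close> is largest, \<open>|w u| \<le> |w t| + L (b - a) |w u|\<close>, and the last
  term is at most half of the left side. As \<open>t\<close> is arbitrary in the interval, the
  estimate also works from the final time.\<close>

lemma norm_le_twice_initial:
  fixes w :: "real \<Rightarrow> 'a::real_normed_vector"
  assumes ac: "abs_continuous a b w" and N: "negligible N" and L: "0 \<le> L" "L * (b - a) \<le> 1 / 2"
    and der: "\<And>s. s \<in> {a..b} - N \<Longrightarrow>
      \<exists>d. norm d \<le> L * norm (w s) \<and> (w has_vector_derivative d) (at s within {a..b})"
    and s: "s \<in> {a..b}" and t: "t \<in> {a..b}"
  shows "norm (w s) \<le> 2 * norm (w t)"
proof -
  have "continuous_on {a..b} (\<lambda>s. norm (w s))"
    by (intro continuous_intros abs_continuous_imp_continuous_on[OF ac])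
  then obtain u where u: "u \<in> {a..b}" "\<And>v. v \<in> {a..b} \<Longrightarrow> norm (w v) \<le> norm (w u)"
    using continuous_attains_sup[of "{a..b}" "\<lambda>s. norm (w s)"] s by auto
  have lip: "(L * norm (w u))-lipschitz_on {a..b} w"
  proof (rule abs_continuous_imp_lipschitz_on[OF ac _ N])
    fix v assume v: "v \<in> {a..b} - N"
    have "L * norm (w v) \<le> L * norm (w u)" using u(2) v L by (intro mult_left_mono) auto
    then show "\<exists>d. norm d \<le> L * norm (w u) \<and> (w has_vector_derivative d) (at v within {a..b})"
      using der[OF v] order_trans by blast
  qed (use L in simp)
  have "norm (w u - w t) \<le> L * norm (w u) * \<bar>u - t\<bar>"
    using lipschitz_onD[OF lip u(1) t] by (simp add: dist_norm)
  also have "\<dots> \<le> L * norm (w u) * (b - a)"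
    using L u(1) t by (intro mult_left_mono) auto
  also have "\<dots> = (L * (b - a)) * norm (w u)" by simp
  also have "\<dots> \<le> 1 / 2 * norm (w u)"
    using L by (intro mult_right_mono) auto
  finally have "norm (w u) \<le> 2 * norm (w t)"
    using norm_triangle_ineq2[of "w u" "w t"] by linarith
  then show ?thesis using u(2)[OF s] by linarith
qed

text \<open>Vanishing at one point spreads to a neighbourhood of fixed size, by the previous
  estimate started at the zero; connectedness of the interval does the rest.\<close>

lemma vanishes_everywhere:
  fixes w :: "real \<Rightarrow> 'a::real_normed_vector"
  assumes ac: "abs_continuous a b w" and N: "negligible N" and L: "0 < L"
    and der: "\<And>s. s \<in> {a..b} - N \<Longrightarrow>
      \<exists>d. norm d \<le> L * norm (w s) \<and> (w has_vector_derivative d) (at s within {a..b})"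
    and s: "s \<in> {a..b}" "w s = 0" and t: "t \<in> {a..b}"
  shows "w t = 0"
proof (rule connected_induction_simple[where S = "{a..b}" and P = "\<lambda>s. w s = 0" and a = s and b = t])
  fix c assume c: "c \<in> {a..b}"
  \<comment> \<open>Two points of this ball are less than \<open>1 / (2 * L)\<close> apart, the
    length at which \<open>L * (j - i) \<le> 1 / 2\<close> holds.\<close>
  define U where "U = {a..b} \<inter> ball c (1 / (4 * L))"
  have "w v = 0" if u: "u \<in> U" "w u = 0" and v: "v \<in> U" for u v
  proof -
    define i j where "i = min u v" and "j = max u v"
    have sub: "{i..j} \<subseteq> {a..b}" using u v by (auto simp: i_def j_def U_def)
    have "j - i \<le> 1 / (2 * L)"
      using u v by (auto simp: i_def j_def U_def dist_real_def field_simps min_def max_def)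
    then have "L * (j - i) \<le> L * (1 / (2 * L))"
      using L by (intro mult_left_mono) auto
    then have small: "L * (j - i) \<le> 1 / 2" using L by simp
    have "norm (w v) \<le> 2 * norm (w u)"
    proof (rule norm_le_twice_initial[OF abs_continuous_subinterval[OF ac sub] N _ small])
      fix s assume "s \<in> {i..j} - N"
      then show "\<exists>d. norm d \<le> L * norm (w s) \<and> (w has_vector_derivative d) (at s within {i..j})"
        using der[of s] sub has_vector_derivative_within_subset by blast
    qed (use L in \<open>auto simp: i_def j_def\<close>)
    then show ?thesis using u(2) by simp
  qed
  moreover have "openin (top_of_set {a..b}) U" "c \<in> U"
    using c L by (auto simp: U_def openin_open_Int)
  ultimately show "\<exists>U. openin (top_of_set {a..b}) U \<and> c \<in> U \<and> (\<forall>u\<in>U. \<forall>v\<in>U. w u = 0 \<longrightarrow> w v = 0)"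
    by blast
qed (use s t in auto)

lemma lipschitz_on_inner_bounded:
  fixes f g :: "'b::metric_space \<Rightarrow> 'a::real_inner"
  assumes f: "L-lipschitz_on S f" "\<And>s. s \<in> S \<Longrightarrow> norm (f s) \<le> A"
    and g: "M-lipschitz_on S g" "\<And>s. s \<in> S \<Longrightarrow> norm (g s) \<le> B" and "0 \<le> A" "0 \<le> B"
  shows "(A * M + L * B)-lipschitz_on S (\<lambda>s. f s \<bullet> g s)"
proof (rule lipschitz_onI)
  fix s t assume s: "s \<in> S" and t: "t \<in> S"
  have "f s \<bullet> g s - f t \<bullet> g t = f s \<bullet> (g s - g t) + (f s - f t) \<bullet> g t"
    by (simp add: inner_diff_left inner_diff_right)
  then have "\<bar>f s \<bullet> g s - f t \<bullet> g t\<bar> \<le> norm (f s) * norm (g s - g t) + norm (f s - f t) * norm (g t)"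
    using Cauchy_Schwarz_ineq2[of "f s" "g s - g t"] Cauchy_Schwarz_ineq2[of "f s - f t" "g t"] by linarith
  also have "\<dots> \<le> A * (M * dist s t) + (L * dist s t) * B"
    using f(2)[OF s] g(2)[OF t] lipschitz_onD[OF f(1) s t] lipschitz_onD[OF g(1) s t] \<open>0 \<le> A\<close>
      lipschitz_on_nonneg[OF f(1)]
    by (intro add_mono mult_mono) (auto simp: dist_norm)
  finally show "dist (f s \<bullet> g s) (f t \<bullet> g t) \<le> (A * M + L * B) * dist s t"
    by (simp add: dist_real_def algebra_simps)
qed (use lipschitz_on_nonneg[OF f(1)] lipschitz_on_nonneg[OF g(1)] \<open>0 \<le> A\<close> \<open>0 \<le> B\<close> in simp)

section \<open>Local solutions of differential equations\<close>

text \<open>Separate continuity in time suffices because the Lipschitz constant in space is uniform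
  in time. This matters for the Hamiltonian field, whose continuity in time is known only with the
  space point held fixed.\<close>

lemma continuous_on_lipschitz_compose:
  fixes h :: "real \<Rightarrow> 'a::real_normed_vector \<Rightarrow> 'b::real_normed_vector"
  assumes cont: "\<And>z. continuous_on S (\<lambda>s. h s z)" and lip: "\<And>s. s \<in> S \<Longrightarrow> L-lipschitz_on UNIV (h s)"
    and y: "continuous_on S y"
  shows "continuous_on S (\<lambda>s. h s (y s))"
  unfolding continuous_on_def
proof
  fix s assume s: "s \<in> S"
  have "((\<lambda>t. h t (y t) - h t (y s)) \<longlongrightarrow> 0) (at s within S)"
  proof (rule Lim_null_comparison)
    have "norm (h t (y t) - h t (y s)) \<le> L * dist (y t) (y s)" if "t \<in> S" for t
      using lipschitz_onD[OF lip[OF that], of "y t" "y s"] by (simp add: dist_norm)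
    then show "\<forall>\<^sub>F t in at s within S. norm (h t (y t) - h t (y s)) \<le> L * dist (y t) (y s)"
      by (simp add: eventually_at_filter)
    have "((\<lambda>t. L * dist (y t) (y s)) \<longlongrightarrow> L * dist (y s) (y s)) (at s within S)"
      using y s by (intro tendsto_intros) (simp add: continuous_on_def)
    then show "((\<lambda>t. L * dist (y t) (y s)) \<longlongrightarrow> 0) (at s within S)" by simp
  qed
  moreover have "((\<lambda>t. h t (y s)) \<longlongrightarrow> h s (y s)) (at s within S)"
    using cont s by (simp add: continuous_on_def)
  ultimately show "((\<lambda>t. h t (y t)) \<longlongrightarrow> h s (y s)) (at s within S)"
    using tendsto_add by fastforce
qed

lemma norm_integral_diff_le:
  fixes f :: "real \<Rightarrow> 'a::banach"
  assumes f: "continuous_on {a..b} f" and B: "\<And>s. s \<in> {a..b} \<Longrightarrow> norm (f s) \<le> B"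
    and s: "s \<in> {a..b}" "t \<in> {a..b}"
  shows "norm (integral {a..s} f - integral {a..t} f) \<le> B * (b - a)"
proof -
  have B0: "B \<ge> 0" using B[OF s(1)] norm_ge_zero order_trans by blast
  have *: "norm (integral {a..v} f - integral {a..u} f) \<le> B * (b - a)"
    if "u \<in> {a..b}" "v \<in> {a..b}" "u \<le> v" for u v
  proof -
    have sub: "continuous_on {c..v} f" if "a \<le> c" for c
      using f by (rule continuous_on_subset) (use that \<open>v \<in> {a..b}\<close> in auto)
    have "integral {a..u} f + integral {u..v} f = integral {a..v} f"
      using that sub[of a] by (intro Henstock_Kurzweil_Integration.integral_combine)
        (auto intro: integrable_continuous_real)
    then have "norm (integral {a..v} f - integral {a..u} f) = norm (integral {u..v} f)"
      by (metis add_diff_cancel_left')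
    also have "\<dots> \<le> B * (v - u)"
      using that B sub[of u] by (intro integral_bound) auto
    also have "\<dots> \<le> B * (b - a)"
      using B0 that by (intro mult_left_mono) auto
    finally show ?thesis .
  qed
  show ?thesis
    using *[of s t] *[of t s] s by (cases "s \<le> t") (auto simp: norm_minus_commute)
qed

text \<open>The integral operator contracts the sup norm with factor \<open>L * (b - a)\<close>. The
  prescribed time \<open>t0\<close> may be any point of the interval; it will be the right endpoint,
  for solving backward.\<close>

lemma picard_lindelof:
  fixes h :: "real \<Rightarrow> 'a::banach \<Rightarrow> 'a"
  assumes t0: "t0 \<in> {a..b}" and L: "L * (b - a) < 1"
    and cont: "\<And>z. continuous_on {a..b} (\<lambda>s. h s z)"
    and lip: "\<And>s. s \<in> {a..b} \<Longrightarrow> L-lipschitz_on UNIV (h s)"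
  obtains y where "y t0 = z"
    "\<And>s. s \<in> {a..b} \<Longrightarrow> (y has_vector_derivative h s (y s)) (at s within {a..b})"
proof -
  have ab: "a \<le> b" using t0 by simp
  have L0: "0 \<le> L" using lipschitz_on_nonneg[OF lip[OF t0]] .
  \<comment> \<open>The integral from \<open>t0\<close> to \<open>s\<close> is written as a
    difference of integrals from \<open>a\<close>, so that \<open>s < t0\<close> needs no oriented
    integral.\<close>
  define I where "I = (\<lambda>(y :: real \<Rightarrow> 'a) s. z + integral {a..s} (\<lambda>u. h u (y u)) - integral {a..t0} (\<lambda>u. h u (y u)))"
  have hc: "continuous_on {a..b} (\<lambda>u. h u (y u))" if "continuous_on {a..b} y" for y
    using continuous_on_lipschitz_compose[OF cont lip that] .
  have I_der: "(I y has_vector_derivative h s (y s)) (at s within {a..b})"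
    if "continuous_on {a..b} y" "s \<in> {a..b}" for y s
    unfolding I_def has_vector_derivative_diff_const
    using has_vector_derivative_add[OF has_vector_derivative_const integral_has_vector_derivative[OF hc[OF that(1)] that(2)]]
    by simp
  \<comment> \<open>Bounded continuous functions on the whole line form the complete space for the
    fixed point theorem. Clamping extends the image of \<open>I\<close> constantly outside
    \<open>{a..b}\<close>; \<open>SOME\<close> only selects the bundled function with these
    values.\<close>
  define J where "J = (\<lambda>y :: real \<Rightarrow>\<^sub>C 'a. SOME g :: real \<Rightarrow>\<^sub>C 'a. \<forall>s. apply_bcontfun g s = I (apply_bcontfun y) (clamp a b s))"
  have J: "apply_bcontfun (J y) s = I (apply_bcontfun y) (clamp a b s)" for y s
  proof -
    have "continuous_on (cbox a b) (I (apply_bcontfun y))"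
      using has_vector_derivative_continuous[OF I_der[of "apply_bcontfun y"]]
      by (simp add: continuous_on_eq_continuous_within[of "{a..b}" "I _"])
    then obtain g :: "real \<Rightarrow>\<^sub>C 'a" where "\<And>s. apply_bcontfun g s = I (apply_bcontfun y) (clamp a b s)"
      using continuous_on_cbox_bcontfunE by metis
    then have "\<forall>s. apply_bcontfun (J y) s = I (apply_bcontfun y) (clamp a b s)"
      unfolding J_def by (intro someI[where P = "\<lambda>g. \<forall>s. apply_bcontfun g s = _ s"]) auto
    then show ?thesis by blast
  qed
  have "\<exists>!y. J y = y"
  proof (rule banach_fix_type[OF _ L], intro mult_nonneg_nonneg L0, use ab in simp, intro allI)
    fix y y' :: "real \<Rightarrow>\<^sub>C 'a"
    show "dist (J y) (J y') \<le> L * (b - a) * dist y y'"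
    proof (rule dist_bound)
      fix s
      define c where "c = clamp a b s"
      have c: "c \<in> {a..b}" using clamp_in_interval[of a b s] ab by (simp add: c_def)
      define k where "k = (\<lambda>u. h u (apply_bcontfun y u) - h u (apply_bcontfun y' u))"
      have k: "integral {a..u} k = integral {a..u} (\<lambda>u. h u (apply_bcontfun y u)) - integral {a..u} (\<lambda>u. h u (apply_bcontfun y' u))"
        if "u \<in> {a..b}" for u
        unfolding k_def
        by (intro integral_diff integrable_continuous_real continuous_on_subset[OF hc]) (use that in auto)
      have "norm (k u) \<le> L * dist y y'" if "u \<in> {a..b}" for u
      proof -
        have "norm (k u) \<le> L * dist (apply_bcontfun y u) (apply_bcontfun y' u)"
          using lipschitz_onD[OF lip[OF that]] by (simp add: k_def dist_norm)
        also have "\<dots> \<le> L * dist y y'"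
          using L0 dist_bounded by (intro mult_left_mono)
        finally show ?thesis .
      qed
      moreover have "continuous_on {a..b} k"
        unfolding k_def by (intro continuous_intros hc) auto
      ultimately have "norm (integral {a..c} k - integral {a..t0} k) \<le> L * dist y y' * (b - a)"
        using c t0 by (intro norm_integral_diff_le)
      then show "dist (apply_bcontfun (J y) s) (apply_bcontfun (J y') s) \<le> L * (b - a) * dist y y'"
        using k[OF c] k[OF t0] by (simp add: J I_def dist_norm flip: c_def) (simp add: algebra_simps)
    qed
  qed
  then obtain y where "J y = y" by blast
  then have fp: "apply_bcontfun y s = I (apply_bcontfun y) s" if "s \<in> {a..b}" for s
    using J[of y s] clamp_cancel_cbox[of s a b] that by simp
  show thesis
  proof (rule that[of "apply_bcontfun y"])
    show "apply_bcontfun y t0 = z" using fp[OF t0] by (simp add: I_def)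
    fix s assume s: "s \<in> {a..b}"
    show "(apply_bcontfun y has_vector_derivative h s (apply_bcontfun y s)) (at s within {a..b})"
      by (rule has_vector_derivative_transform[OF s _ I_der[of "apply_bcontfun y"]]) (use fp s in auto)
  qed
qed

lemma bounded_vector_derivative_imp_lipschitz_on:
  assumes der: "\<And>s. s \<in> {a..b} \<Longrightarrow> (w has_vector_derivative w' s) (at s within {a..b})"
    and B: "\<And>s. s \<in> {a..b} \<Longrightarrow> norm (w' s) \<le> B" "0 \<le> B"
  shows "B-lipschitz_on {a..b} w"
proof (rule lipschitz_onI)
  fix u v assume "u \<in> {a..b}" "v \<in> {a..b}"
  moreover have "onorm (\<lambda>h. h *\<^sub>R w' s) \<le> B" if "s \<in> {a..b}" for s
    using B(1)[OF that] onorm_scaleR_left[OF bounded_linear_ident, of "w' s"] by (simp add: onorm_id)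
  ultimately have "norm (w u - w v) \<le> B * norm (u - v)"
    using der unfolding has_vector_derivative_def
    by (intro differentiable_bound[where S = "{a..b}" and f' = "\<lambda>s h. h *\<^sub>R w' s"]) auto
  then show "dist (w u) (w v) \<le> B * dist u v" by (simp add: dist_norm)
qed (fact B(2))

section \<open>Semiconvex functions\<close>

text \<open>Halving the increment repeatedly and summing the midpoint inequalities gives a geometric series;
  the difference quotients converge to the directional derivative.\<close>

lemma semiconvex_on_gderiv_le:
  fixes g :: "'a::real_inner \<Rightarrow> real"
  assumes g: "semiconvex_on \<Omega> c g" "convex \<Omega>" and w: "w \<in> \<Omega>" and y: "y \<in> \<Omega>"
    and der: "GDERIV g w :> v"
  shows "v \<bullet> (y - w) - c / 2 * (norm (y - w))\<^sup>2 \<le> g y - g w"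
proof -
  define u where "u = y - w"
  \<comment> \<open>The difference quotient with step \<open>2 ^ (- n)\<close>: \<open>D 0\<close>
    is \<open>g y - g w\<close>, and \<open>D n\<close> tends to
    \<open>v \<bullet> u\<close>.\<close>
  define D where "D = (\<lambda>n::nat. 2 ^ n * (g (w + (1 / 2 ^ n) *\<^sub>R u) - g w))"
  have mem: "w + (1 / 2 ^ n) *\<^sub>R u \<in> \<Omega>" for n :: nat
  proof -
    have "(1 - 1 / 2 ^ n) *\<^sub>R w + (1 / 2 ^ n) *\<^sub>R y \<in> \<Omega>"
      using g(2) w y by (intro convexD) auto
    then show ?thesis by (simp add: u_def algebra_simps)
  qed
  have step: "D n - D (Suc n) \<ge> - c * (norm u)\<^sup>2 / (4 * 2 ^ n)" for n
  proof -
    define k where "k = (1 / 2 ^ Suc n) *\<^sub>R u"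
    have kk: "k + k = (1 / 2 ^ n) *\<^sub>R u"
      unfolding k_def by (simp flip: scaleR_add_left)
    then have e: "w + k + k = w + (1 / 2 ^ n) *\<^sub>R u" "w + k - k = w"
      by (simp_all add: add.assoc)
    have "closed_segment (w + k - k) (w + k + k) \<subseteq> \<Omega>"
      unfolding e using g(2) w mem by (intro closed_segment_subset)
    then have "g (w + k + k) + g (w + k - k) - 2 * g (w + k) \<ge> - c * (norm k)\<^sup>2"
      using g(1) unfolding semiconvex_on_def by blast
    then have "2 ^ n * (g (w + (1 / 2 ^ n) *\<^sub>R u) + g w - 2 * g (w + k)) \<ge> 2 ^ n * (- c * (norm k)\<^sup>2)"
      unfolding e by (intro mult_left_mono) auto
    moreover have "2 ^ n * (- c * (norm k)\<^sup>2) = - c * (norm u)\<^sup>2 / (4 * 2 ^ n)"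
      by (simp add: k_def power2_eq_square field_simps)
    ultimately show ?thesis
      by (simp add: D_def k_def algebra_simps)
  qed
  \<comment> \<open>The losses \<open>c |u|^2 / (4 * 2 ^ j)\<close> for \<open>j < n\<close> add up
    to \<open>c / 2 * |u|^2 * (1 - (1 / 2) ^ n)\<close>.\<close>
  have lower: "D 0 \<ge> D n - c / 2 * (norm u)\<^sup>2 * (1 - (1 / 2) ^ n)" for n
  proof (induction n)
    case (Suc n)
    then show ?case using step[of n] by (simp add: field_simps)
  qed simp
  have "((\<lambda>t. g (w + t *\<^sub>R u)) has_real_derivative v \<bullet> u) (at 0)"
  proof -
    have "(g has_derivative (\<lambda>h. h \<bullet> v)) (at (w + 0 *\<^sub>R u))"
      using der by (simp add: gderiv_def)
    moreover have "((\<lambda>t. w + t *\<^sub>R u) has_derivative (\<lambda>t. t *\<^sub>R u)) (at 0)"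
      by (auto intro!: derivative_eq_intros)
    ultimately have "((\<lambda>t. g (w + t *\<^sub>R u)) has_derivative (\<lambda>t. (t *\<^sub>R u) \<bullet> v)) (at 0)"
      by (rule has_derivative_compose[rotated])
    moreover have "(\<lambda>t. (t *\<^sub>R u) \<bullet> v) = (*) (v \<bullet> u)"
      by (simp add: fun_eq_iff inner_commute)
    ultimately show ?thesis
      by (simp add: has_field_derivative_def)
  qed
  then have lim: "((\<lambda>t. (g (w + t *\<^sub>R u) - g w) / t) \<longlongrightarrow> v \<bullet> u) (at 0)"
    by (simp add: has_field_derivative_iff)
  have "filterlim (\<lambda>n. (1 / 2) ^ n :: real) (at 0) sequentially"
    unfolding filterlim_at by (auto intro!: LIMSEQ_realpow_zero)
  from filterlim_compose[OF lim this]
  have "D \<longlonglongrightarrow> v \<bullet> u"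
    by (simp add: D_def power_divide mult.commute)
  moreover have "(\<lambda>n. (1 / 2) ^ n :: real) \<longlonglongrightarrow> 0"
    by (rule LIMSEQ_realpow_zero) auto
  ultimately have "(\<lambda>n. D n - c / 2 * (norm u)\<^sup>2 * (1 - (1 / 2) ^ n)) \<longlonglongrightarrow>
      v \<bullet> u - c / 2 * (norm u)\<^sup>2 * (1 - 0)"
    by (intro tendsto_diff tendsto_mult tendsto_const)
  then have "v \<bullet> u - c / 2 * (norm u)\<^sup>2 * (1 - 0) \<le> D 0"
    using lower by (intro LIMSEQ_le_const2) auto
  then show ?thesis by (simp add: D_def u_def)
qed

text \<open>For fixed \<open>y\<close> the inequality is affine in \<open>\<zeta>\<close>, so it
  cuts out a half-space. The limiting gradients lie in it by passing to the limit in the bound at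
  points of differentiability, and therefore so does their convex hull.\<close>

lemma clarke_gradient_semiconvex_on:
  fixes g :: "'a::euclidean_space \<Rightarrow> real"
  assumes g: "semiconvex_on \<Omega> c g" "convex \<Omega>" "open \<Omega>" and x: "x \<in> \<Omega>" and y: "y \<in> \<Omega>"
    and \<zeta>: "\<zeta> \<in> clarke_gradient g x"
  shows "\<zeta> \<bullet> (y - x) - c / 2 * (norm (y - x))\<^sup>2 \<le> g y - g x"
proof -
  define H where "H = {\<zeta>. (y - x) \<bullet> \<zeta> \<le> g y - g x + c / 2 * (norm (y - x))\<^sup>2}"
  have "clarke_gradient g x \<subseteq> H"
    unfolding clarke_gradient_def
  proof (rule hull_minimal)
    show "convex H" unfolding H_def by (rule convex_halfspace_le)
    show "{v. \<exists>z G. z \<longlonglongrightarrow> x \<and> (\<forall>i::nat. GDERIV g (z i) :> G i) \<and> G \<longlonglongrightarrow> v} \<subseteq> H"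
    proof safe
      fix v and z G :: "nat \<Rightarrow> 'a"
      assume z: "z \<longlonglongrightarrow> x" "\<forall>i. GDERIV g (z i) :> G i" "G \<longlonglongrightarrow> v"
      have ev: "\<forall>\<^sub>F i in sequentially. G i \<bullet> (y - z i) - c / 2 * (norm (y - z i))\<^sup>2 \<le> g y - g (z i)"
        using topological_tendstoD[OF z(1) g(3) x]
        by eventually_elim (use semiconvex_on_gderiv_le[OF g(1,2)] y z(2) in blast)
      have gx: "isCont g x"
        using g(1,3) x by (simp add: semiconvex_on_def continuous_on_eq_continuous_at)
      have "(\<lambda>i. g (z i)) \<longlonglongrightarrow> g x"
        by (rule isCont_tendsto_compose[OF gx z(1)])
      note lim = this z
      have "v \<bullet> (y - x) - c / 2 * (norm (y - x))\<^sup>2 \<le> g y - g x"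
        by (rule tendsto_le[OF sequentially_bot _ _ ev]) (intro tendsto_intros lim)+
      then show "v \<in> H" by (simp add: H_def inner_commute)
    qed
  qed
  then have "(y - x) \<bullet> \<zeta> \<le> g y - g x + c / 2 * (norm (y - x))\<^sup>2"
    using \<zeta> by (auto simp: H_def)
  then show ?thesis by (simp add: inner_commute)
qed

text \<open>Test the preceding inequality at \<open>x + t *\<^sub>R \<zeta>\<close>, divide by
  \<open>t * norm \<zeta>\<close> and let \<open>t\<close> decrease to 0; the quadratic term
  disappears.\<close>

lemma clarke_gradient_norm_le:
  fixes g :: "'a::euclidean_space \<Rightarrow> real"
  assumes g: "semiconvex_on \<Omega> c g" "convex \<Omega>" "open \<Omega>" and lip: "M-lipschitz_on \<Omega> g"
    and x: "x \<in> \<Omega>" and \<zeta>: "\<zeta> \<in> clarke_gradient g x"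
  shows "norm \<zeta> \<le> M"
proof (cases "\<zeta> = 0")
  case True
  then show ?thesis using lipschitz_on_nonneg[OF lip] by simp
next
  case False
  have "((\<lambda>t. x + t *\<^sub>R \<zeta>) \<longlongrightarrow> x + 0 *\<^sub>R \<zeta>) (at_right 0)"
    by (intro tendsto_intros)
  then have "\<forall>\<^sub>F t in at_right 0. x + t *\<^sub>R \<zeta> \<in> \<Omega>"
    using g(3) x topological_tendstoD by fastforce
  then have "\<forall>\<^sub>F t in at_right 0. norm \<zeta> - c / 2 * t * norm \<zeta> \<le> M"
    using eventually_at_right_less[of 0]
  proof eventually_elim
    case (elim t)
    have "\<zeta> \<bullet> (t *\<^sub>R \<zeta>) - c / 2 * (norm (t *\<^sub>R \<zeta>))\<^sup>2 \<le> g (x + t *\<^sub>R \<zeta>) - g x"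
      using clarke_gradient_semiconvex_on[OF g x elim(1) \<zeta>] by simp
    also have "\<dots> \<le> M * norm (t *\<^sub>R \<zeta>)"
      using lipschitz_onD[OF lip elim(1) x] by (auto simp: dist_norm)
    finally have "(t * norm \<zeta>) * (norm \<zeta> - c / 2 * t * norm \<zeta>) \<le> (t * norm \<zeta>) * M"
      using elim(2) by (simp add: power2_norm_eq_inner[symmetric] power2_eq_square algebra_simps)
    then show ?case
      using elim(2) False by (simp add: mult_le_cancel_left)
  qed
  moreover have "((\<lambda>t. norm \<zeta> - c / 2 * t * norm \<zeta>) \<longlongrightarrow> norm \<zeta> - c / 2 * 0 * norm \<zeta>) (at_right 0)"
    by (intro tendsto_intros)
  ultimately have "norm \<zeta> - c / 2 * 0 * norm \<zeta> \<le> M"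
    by (intro tendsto_upperbound) auto
  then show ?thesis by simp
qed

section \<open>The Hamiltonian\<close>

locale differential_inclusion =
  fixes F :: "'a::euclidean_space \<Rightarrow> 'a set"
  assumes F: "assumption_F F"
begin

section \<open>Support function calculus for \<open>F x\<close>\<close>

lemma F_nonempty: "F x \<noteq> {}" and F_compact: "compact (F x)"
  using F unfolding assumption_F_def by auto

lemma max_ham_attained:
  obtains v where "v \<in> F x" "v \<bullet> p = max_ham F x p"
proof -
  have "continuous_on (F x) (\<lambda>v. v \<bullet> p)" by (intro continuous_intros)
  then obtain v where v: "v \<in> F x" "\<And>w. w \<in> F x \<Longrightarrow> w \<bullet> p \<le> v \<bullet> p"
    using continuous_attains_sup[OF F_compact F_nonempty] by blast
  then have "max_ham F x p = v \<bullet> p"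
    unfolding max_ham_def by (intro cSup_eq_maximum) auto
  then show thesis using that v(1) by simp
qed

lemma inner_le_max_ham:
  assumes "v \<in> F x"
  shows "v \<bullet> p \<le> max_ham F x p"
proof -
  have "bounded ((\<lambda>v. v \<bullet> p) ` F x)"
    by (intro compact_imp_bounded compact_continuous_image F_compact continuous_intros)
  then show ?thesis
    unfolding max_ham_def using assms by (intro cSUP_upper bounded_imp_bdd_above)
qed

lemma max_ham_le_iff: "max_ham F x p \<le> c \<longleftrightarrow> (\<forall>v\<in>F x. v \<bullet> p \<le> c)"
  by (metis inner_le_max_ham max_ham_attained order_trans)

lemma max_ham_zero [simp]: "max_ham F x 0 = 0"
proof -
  obtain v where "v \<bullet> 0 = max_ham F x 0" using max_ham_attained[of x 0] by auto
  then show ?thesis by simp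
qed

lemma max_ham_scaleR:
  assumes "c \<ge> 0"
  shows "max_ham F x (c *\<^sub>R p) = c * max_ham F x p"
proof (rule antisym)
  show "max_ham F x (c *\<^sub>R p) \<le> c * max_ham F x p"
    using assms inner_le_max_ham by (auto simp: max_ham_le_iff intro: mult_left_mono)
  obtain v where "v \<in> F x" "v \<bullet> p = max_ham F x p"
    using max_ham_attained .
  then show "c * max_ham F x p \<le> max_ham F x (c *\<^sub>R p)"
    using inner_le_max_ham[of v x "c *\<^sub>R p"] by simp
qed

lemma min_ham_minus: "min_ham F x (- p) = - max_ham F x p"
  unfolding min_ham_def max_ham_def by (simp add: Inf_real_def image_image)

text \<open>Condition (F2) moves a maximiser at \<open>x\<close> into \<open>F y\<close> up to an
  error of norm \<open>L |y - x|\<close>. The explicit factor \<open>norm p\<close> is what later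
  gives \<open>|p'| \<le> L |p|\<close> for the adjoint arc.\<close>

lemma lipschitz_on_max_ham:
  assumes "compact Q"
  obtains L where "L > 0" "\<And>p. (L * norm p)-lipschitz_on Q (\<lambda>x. max_ham F x p)"
proof -
  obtain L where L: "L > 0" and sub: "\<And>x y. x \<in> Q \<Longrightarrow> y \<in> Q \<Longrightarrow>
      F x \<subseteq> {w + (L * norm (y - x)) *\<^sub>R u | w u. w \<in> F y \<and> u \<in> cball 0 1}"
    using F assms unfolding assumption_F_def by meson
  have le: "max_ham F x p \<le> max_ham F y p + L * norm p * norm (y - x)"
    if xy: "x \<in> Q" "y \<in> Q" for x y p
    unfolding max_ham_le_iff
  proof
    fix v assume "v \<in> F x"
    then obtain w u where w: "w \<in> F y" "norm u \<le> 1" "v = w + (L * norm (y - x)) *\<^sub>R u"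
      using sub[OF xy] by auto
    have "u \<bullet> p \<le> norm u * norm p" by (rule norm_cauchy_schwarz)
    also have "\<dots> \<le> norm p" using w(2) by (simp add: mult_left_le_one_le)
    finally have "(L * norm (y - x)) * (u \<bullet> p) \<le> (L * norm (y - x)) * norm p"
      using L by (intro mult_left_mono) auto
    then show "v \<bullet> p \<le> max_ham F y p + L * norm p * norm (y - x)"
      using inner_le_max_ham[OF w(1), of p] w(3) by (simp add: inner_add_left mult_ac)
  qed
  have "(L * norm p)-lipschitz_on Q (\<lambda>x. max_ham F x p)" for p
  proof (rule lipschitz_onI)
    fix x y assume "x \<in> Q" "y \<in> Q"
    then show "dist (max_ham F x p) (max_ham F y p) \<le> L * norm p * dist x y"
      using le[of x y p] le[of y x p] by (auto simp: dist_norm norm_minus_commute abs_le_iff)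
  qed (use L in simp)
  with L that show thesis by blast
qed

lemma F_bounded:
  obtains \<gamma> where "\<gamma> > 0" "\<And>x v. v \<in> F x \<Longrightarrow> norm v \<le> \<gamma> * (1 + norm x)"
  using F unfolding assumption_F_def by metis

text \<open>For any maximiser \<open>v\<close> at \<open>p\<close>, the function
  \<open>max_ham F x q - v \<bullet> q\<close> of \<open>q\<close> attains its minimum at
  \<open>p\<close>, so its derivative \<open>G - v\<close> vanishes there. Compactness supplies a
  maximiser.\<close>

lemma gderiv_max_ham_in_F:
  assumes "GDERIV (max_ham F x) p :> G"
  shows "G \<in> F x" "G \<bullet> p = max_ham F x p" "v \<in> F x \<Longrightarrow> v \<bullet> p = max_ham F x p \<Longrightarrow> v = G"
proof -
  have uniq: "v = G" if v: "v \<in> F x" "v \<bullet> p = max_ham F x p" for v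
  proof -
    have "((\<lambda>q. max_ham F x q - v \<bullet> q) has_derivative (\<lambda>h. h \<bullet> G - v \<bullet> h)) (at p)"
      using assms unfolding gderiv_def by (auto intro!: derivative_eq_intros)
    moreover have "\<forall>\<^sub>F q in at p. max_ham F x p - v \<bullet> p \<le> max_ham F x q - v \<bullet> q"
      using inner_le_max_ham[OF v(1)] v(2) by simp
    ultimately have "(\<lambda>h. h \<bullet> G - v \<bullet> h) = (\<lambda>h. 0)"
      by (intro has_derivative_local_min) auto
    then have "(G - v) \<bullet> (G - v) = 0"
      by (metis inner_commute inner_diff_right)
    then show ?thesis by simp
  qed
  obtain w where "w \<in> F x" "w \<bullet> p = max_ham F x p"
    using max_ham_attained .
  then show "G \<in> F x" "G \<bullet> p = max_ham F x p" using uniq by auto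
  show "v \<in> F x \<Longrightarrow> v \<bullet> p = max_ham F x p \<Longrightarrow> v = G" by (rule uniq)
qed

text \<open>A maximiser is a subgradient of the convex function \<open>max_ham F x\<close>.\<close>

lemma max_ham_diff_le:
  assumes "v \<in> F x" "v \<bullet> p = max_ham F x p"
  shows "v \<bullet> (q - p) \<le> max_ham F x q - max_ham F x p"
  using inner_le_max_ham[OF assms(1), of q] assms(2) by (simp add: inner_diff_right)

lemma lipschitz_on_max_ham_right:
  assumes "\<And>v. v \<in> F x \<Longrightarrow> norm v \<le> M" 
  shows "M-lipschitz_on UNIV (max_ham F x)"
proof (rule lipschitz_onI)
  have le: "max_ham F x p - max_ham F x q \<le> M * norm (p - q)" for p q
  proof -
    obtain v where v: "v \<in> F x" "v \<bullet> p = max_ham F x p" using max_ham_attained .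
    have "max_ham F x p - max_ham F x q \<le> v \<bullet> (p - q)"
      using max_ham_diff_le[OF v, of q] by (simp add: inner_diff_right)
    also have "\<dots> \<le> norm v * norm (p - q)" by (rule norm_cauchy_schwarz)
    also have "\<dots> \<le> M * norm (p - q)" using assms[OF v(1)] by (intro mult_right_mono) auto
    finally show ?thesis .
  qed
  show "dist (max_ham F x p) (max_ham F x q) \<le> M * dist p q" for p q
    using le[of p q] le[of q p] by (auto simp: dist_norm norm_minus_commute abs_le_iff)
  show "M \<ge> 0" using assms F_nonempty norm_ge_zero order_trans by (metis ex_in_conv)
qed

text \<open>For \<open>p \<noteq> 0\<close> under assumption (H) this is the gradient of the Hamiltonian in \<open>p\<close>; the choice is
  arbitrary where the maximiser is not unique.\<close>

definition argmax_ham :: "'a \<Rightarrow> 'a \<Rightarrow> 'a"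
  where "argmax_ham x p = (SOME v. v \<in> F x \<and> v \<bullet> p = max_ham F x p)"

lemma argmax_ham: "argmax_ham x p \<in> F x" "argmax_ham x p \<bullet> p = max_ham F x p"
proof -
  have "\<exists>v. v \<in> F x \<and> v \<bullet> p = max_ham F x p" using max_ham_attained by metis
  then show "argmax_ham x p \<in> F x" "argmax_ham x p \<bullet> p = max_ham F x p"
    unfolding argmax_ham_def by (metis (mono_tags, lifting) someI_ex)+
qed

lemma gderiv_max_ham_eq_argmax:
  assumes "GDERIV (max_ham F x) p :> G"
  shows "G = argmax_ham x p"
  using gderiv_max_ham_in_F(3)[OF assms argmax_ham] by simp

text \<open>A limit of maximisers is a maximiser, so uniqueness of the maximiser at \<open>p\<close> forces convergence.\<close>

lemma isCont_argmax_ham: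
  assumes "GDERIV (max_ham F x) p :> G"
  shows "isCont (argmax_ham x) p"
proof (rule ccontr)
  assume "\<not> ?thesis"
  then obtain e where e: "e > 0" and "\<And>d. d > 0 \<Longrightarrow> \<exists>q. dist q p < d \<and> dist (argmax_ham x q) (argmax_ham x p) \<ge> e"
    unfolding continuous_at_eps_delta by (metis not_le dist_norm)
  then have "\<forall>n. \<exists>q. dist q p < 1 / real (Suc n) \<and> dist (argmax_ham x q) (argmax_ham x p) \<ge> e"
    by simp
  then obtain q where q: "\<And>n. dist (q n) p < 1 / real (Suc n)"
      "\<And>n. dist (argmax_ham x (q n)) (argmax_ham x p) \<ge> e"
    by metis
  have q_lim: "q \<longlonglongrightarrow> p"
  proof (rule metric_LIMSEQ_I)
    fix d :: real assume "d > 0"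
    then obtain m where m: "1 / real (Suc m) < d" by (rule nat_approx_posE)
    have "dist (q n) p < d" if "n \<ge> m" for n
    proof -
      have "dist (q n) p < 1 / real (Suc n)" by (rule q)
      also have "\<dots> \<le> 1 / real (Suc m)" using that by (simp add: frac_le)
      finally show ?thesis using m by simp
    qed
    then show "\<exists>m. \<forall>n\<ge>m. dist (q n) p < d" by blast
  qed
  have "\<forall>n. argmax_ham x (q n) \<in> F x" using argmax_ham by simp
  then obtain v r where v: "v \<in> F x" "strict_mono r" "((\<lambda>n. argmax_ham x (q n)) \<circ> r) \<longlonglongrightarrow> v"
    using F_compact[of x] unfolding compact_def by metis
  have qr: "(\<lambda>n. q (r n)) \<longlonglongrightarrow> p"
    using LIMSEQ_subseq_LIMSEQ[OF q_lim v(2)] by (simp add: o_def)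
  have "(\<lambda>n. argmax_ham x (q (r n)) \<bullet> q (r n)) \<longlonglongrightarrow> v \<bullet> p"
    using v(3) qr by (intro tendsto_intros) (simp add: o_def)
  moreover have "(\<lambda>n. max_ham F x (q (r n))) \<longlonglongrightarrow> max_ham F x p"
  proof -
    obtain \<gamma> where "\<And>x v. v \<in> F x \<Longrightarrow> norm v \<le> \<gamma> * (1 + norm x)" using F_bounded by metis
    then have "continuous_on UNIV (max_ham F x)"
      using lipschitz_on_max_ham_right lipschitz_on_continuous_on by blast
    then have "isCont (max_ham F x) p"
      by (simp add: continuous_on_eq_continuous_at)
    then show ?thesis
      using qr by (rule isCont_tendsto_compose)
  qed
  ultimately have "v \<bullet> p = max_ham F x p"
    unfolding argmax_ham(2) by (rule LIMSEQ_unique)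
  then have "v = argmax_ham x p"
    using gderiv_max_ham_in_F(3)[OF assms v(1)] gderiv_max_ham_eq_argmax[OF assms] by simp
  then have "(\<lambda>n. dist (argmax_ham x (q (r n))) (argmax_ham x p)) \<longlonglongrightarrow> 0"
    using v(3) tendsto_dist_iff unfolding o_def by metis
  then have "e \<le> 0"
    by (rule LIMSEQ_le_const) (use q(2) in blast)
  then show False using e by simp
qed

end

locale semiconvex_inclusion = differential_inclusion +
  assumes H: "assumption_H F"
begin

text \<open>Positive homogeneity in \<open>p\<close> carries (H1) from the unit sphere to all
  \<open>p\<close>, with the constant scaled by \<open>norm p\<close>.\<close>

lemma semiconvex_on_max_ham:
  assumes "r > 0"
  obtains c where "c \<ge> 0" "\<And>p. semiconvex_on (ball 0 r) (c * norm p) (\<lambda>x. max_ham F x p)"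
proof -
  obtain c where c: "c \<ge> 0" "\<And>p. p \<in> sphere 0 1 \<Longrightarrow> semiconvex_on (ball 0 r) c (\<lambda>x. max_ham F x p)"
    using H assms unfolding assumption_H_def by meson
  have "semiconvex_on (ball 0 r) (c * norm p) (\<lambda>x. max_ham F x p)" for p
  proof (cases "p = 0")
    case True
    then show ?thesis by (simp add: semiconvex_on_def)
  next
    case False
    define e where "e = sgn p"
    have p: "max_ham F x p = norm p * max_ham F x e" for x
      using max_ham_scaleR[of "norm p" x e] False by (simp add: e_def sgn_div_norm)
    have e: "semiconvex_on (ball 0 r) c (\<lambda>x. max_ham F x e)"
      using c(2)[of e] False by (simp add: e_def norm_sgn)
    show ?thesis
      unfolding semiconvex_on_def
    proof (intro conjI allI impI)
      show "continuous_on (ball 0 r) (\<lambda>x. max_ham F x p)"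
        unfolding p using e by (intro continuous_intros) (simp add: semiconvex_on_def)
      fix x k :: 'a
      assume "closed_segment (x - k) (x + k) \<subseteq> ball 0 r"
      then have "- c * (norm k)\<^sup>2 \<le> max_ham F (x + k) e + max_ham F (x - k) e - 2 * max_ham F x e"
        using e unfolding semiconvex_on_def by blast
      then have "norm p * (- c * (norm k)\<^sup>2) \<le> norm p * (max_ham F (x + k) e + max_ham F (x - k) e - 2 * max_ham F x e)"
        by (rule mult_left_mono) simp
      then show "- (c * norm p) * (norm k)\<^sup>2 \<le> max_ham F (x + k) p + max_ham F (x - k) p - 2 * max_ham F x p"
        unfolding p by (simp add: algebra_simps)
    qed
  qed
  with c(1) that show thesis by blast
qed

lemma gderiv_argmax_ham:
  assumes "p \<noteq> 0"
  shows "GDERIV (max_ham F x) p :> argmax_ham x p"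
proof -
  have "norm x + 1 > 0" by (simp add: add_nonneg_pos)
  then obtain G where "\<forall>y\<in>ball 0 (norm x + 1). GDERIV (max_ham F y) p :> G y"
    using H assms unfolding assumption_H_def by meson
  then have "GDERIV (max_ham F x) p :> G x" by simp
  then show ?thesis using gderiv_max_ham_eq_argmax by metis
qed

lemma lipschitz_on_argmax_ham:
  assumes "r > 0"
  obtains L where "L > 0" "\<And>p. p \<noteq> 0 \<Longrightarrow> L-lipschitz_on (ball 0 r) (\<lambda>x. argmax_ham x p)"
proof -
  obtain L where L: "\<And>p. p \<noteq> 0 \<Longrightarrow>
      \<exists>G. (\<forall>x\<in>ball 0 r. GDERIV (max_ham F x) p :> G x) \<and> L-lipschitz_on (ball 0 r) G"
    using H assms unfolding assumption_H_def by meson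
  \<comment> \<open>The constant in (H2) could be zero; a positive one is wanted because the later
    step length is \<open>1 / (2 * L)\<close>.\<close>
  have "(max L 1)-lipschitz_on (ball 0 r) (\<lambda>x. argmax_ham x p)" if p: "p \<noteq> 0" for p
  proof -
    obtain G where G: "\<And>x. x \<in> ball 0 r \<Longrightarrow> GDERIV (max_ham F x) p :> G x" "L-lipschitz_on (ball 0 r) G"
      using L[OF p] by blast
    have "(max L 1)-lipschitz_on (ball 0 r) G"
      using G(2) by (rule lipschitz_on_le) simp
    then show ?thesis
      by (rule lipschitz_on_transform) (use gderiv_max_ham_eq_argmax[OF G(1)] in simp)
  qed
  then show thesis using that[of "max L 1"] by simp
qed

end

section \<open>Trajectories and minimum time\<close>

lemma has_vector_derivative_shift_Icc:
  assumes "(x has_vector_derivative v) (at (t + s) within {t + a..t + b})"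
  shows "((\<lambda>s. x (t + s)) has_vector_derivative v) (at s within {a..b})"
proof -
  have "((+) t has_vector_derivative 1) (at s within {a..b})"
    by (auto intro!: derivative_eq_intros)
  then show ?thesis
    using vector_diff_chain_within[of "(+) t" 1 s "{a..b}" x v] assms
    by (simp add: o_def add.commute)
qed

lemma min_time_nonneg: "0 \<le> min_time F K x"
  unfolding min_time_def by (auto intro!: Inf_greatest)

context differential_inclusion
begin

text \<open>An absolutely continuous arc on a compact interval is bounded, so (F3) bounds its
  velocities almost everywhere.\<close>

lemma trajectory_iff:
  "trajectory F T x0 x \<longleftrightarrow> (\<exists>M. M-lipschitz_on {0..T} x) \<and>
    (\<exists>N. negligible N \<and> (\<forall>s\<in>{0..T} - N. \<exists>v\<in>F (x s). (x has_vector_derivative v) (at s within {0..T}))) \<and>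
    x 0 = x0"
    (is "?L \<longleftrightarrow> ?R")
proof
  assume ?R
  then show ?L
    unfolding trajectory_def by (auto simp: AE_lebesgue_on_iff_negligible intro: lipschitz_on_imp_abs_continuous)
next
  assume L: ?L
  then obtain N where N: "negligible N"
      "\<forall>s\<in>{0..T} - N. \<exists>v\<in>F (x s). (x has_vector_derivative v) (at s within {0..T})"
    unfolding trajectory_def by (auto simp: AE_lebesgue_on_iff_negligible)
  have ac: "abs_continuous 0 T x" and x0: "x 0 = x0"
    using L by (auto simp: trajectory_def)
  have "bounded (x ` {0..T})"
    by (intro compact_imp_bounded compact_continuous_image abs_continuous_imp_continuous_on[OF ac]) auto
  then obtain B where B: "B > 0" "\<And>s. s \<in> {0..T} \<Longrightarrow> norm (x s) \<le> B"
    unfolding bounded_pos by blast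
  obtain \<gamma> where \<gamma>: "\<gamma> > 0" "\<And>x v. v \<in> F x \<Longrightarrow> norm v \<le> \<gamma> * (1 + norm x)"
    using F_bounded by blast
  have "(\<gamma> * (1 + B))-lipschitz_on {0..T} x"
  proof (rule abs_continuous_imp_lipschitz_on[OF ac _ N(1)])
    show "0 \<le> \<gamma> * (1 + B)" using \<gamma>(1) B(1) by simp
    fix s assume s: "s \<in> {0..T} - N"
    then obtain v where v: "v \<in> F (x s)" "(x has_vector_derivative v) (at s within {0..T})"
      using N(2) by blast
    have "norm v \<le> \<gamma> * (1 + norm (x s))" by (rule \<gamma>(2)[OF v(1)])
    also have "\<dots> \<le> \<gamma> * (1 + B)" using \<gamma>(1) B(2)[of s] s by (intro mult_left_mono) auto
    finally show "\<exists>d. norm d \<le> \<gamma> * (1 + B) \<and> (x has_vector_derivative d) (at s within {0..T})"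
      using v(2) by blast
  qed
  then show ?R using N x0 by blast
qed

lemma trajectory_shift:
  assumes x: "trajectory F T x0 x" and t: "0 \<le> t" "t + S \<le> T"
  shows "trajectory F S (x t) (\<lambda>s. x (t + s))"
proof -
  obtain M N where M: "M-lipschitz_on {0..T} x" and N: "negligible N"
      "\<And>s. s \<in> {0..T} - N \<Longrightarrow> \<exists>v\<in>F (x s). (x has_vector_derivative v) (at s within {0..T})"
    using x unfolding trajectory_iff by blast
  have "M-lipschitz_on {0..S} (\<lambda>s. x (t + s))"
  proof (rule lipschitz_onI)
    fix u v assume "u \<in> {0..S}" "v \<in> {0..S}"
    then show "dist (x (t + u)) (x (t + v)) \<le> M * dist u v"
      using lipschitz_onD[OF M, of "t + u" "t + v"] t by simp
  qed (rule lipschitz_on_nonneg[OF M])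
  moreover have "\<exists>v\<in>F (x (t + s)). ((\<lambda>s. x (t + s)) has_vector_derivative v) (at s within {0..S})"
    if s: "s \<in> {0..S} - (+) (- t) ` N" for s
  proof -
    have "t + s \<notin> N" using s by force
    then obtain v where v: "v \<in> F (x (t + s))" "(x has_vector_derivative v) (at (t + s) within {0..T})"
      using N(2)[of "t + s"] s t by auto
    have "(x has_vector_derivative v) (at (t + s) within {t + 0..t + (S)})"
      by (rule has_vector_derivative_within_subset[OF v(2)]) (use t in auto)
    then show ?thesis using v(1) has_vector_derivative_shift_Icc by blast
  qed
  moreover have "negligible ((+) (- t) ` N)"
    using N(1) by (rule negligible_translation)
  ultimately show ?thesis unfolding trajectory_iff by auto
qed

lemma trajectory_concat:
  assumes x: "trajectory F T x0 x" and y: "trajectory F S (x T) y" and T: "0 \<le> T" and S: "0 \<le> S"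
  defines "z \<equiv> \<lambda>s. if s \<le> T then x s else y (s - T)"
  shows "trajectory F (T + S) x0 z" "z (T + S) = y S"
proof -
  obtain M N where M: "M-lipschitz_on {0..T} x" and N: "negligible N"
      "\<And>s. s \<in> {0..T} - N \<Longrightarrow> \<exists>v\<in>F (x s). (x has_vector_derivative v) (at s within {0..T})"
      and x0: "x 0 = x0"
    using x unfolding trajectory_iff by blast
  obtain M' N' where M': "M'-lipschitz_on {0..S} y" and N': "negligible N'"
      "\<And>s. s \<in> {0..S} - N' \<Longrightarrow> \<exists>v\<in>F (y s). (y has_vector_derivative v) (at s within {0..S})"
      and y0: "y 0 = x T"
    using y unfolding trajectory_iff by blast
  have "M'-lipschitz_on {T..T + S} (\<lambda>s. y (s - T))"
  proof (rule lipschitz_onI)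
    fix u v assume "u \<in> {T..T + S}" "v \<in> {T..T + S}"
    then show "dist (y (u - T)) (y (v - T)) \<le> M' * dist u v"
      using lipschitz_onD[OF M', of "u - T" "v - T"] by (simp add: dist_real_def)
  qed (rule lipschitz_on_nonneg[OF M'])
  then have "(max M M')-lipschitz_on {0..T + S} z"
    unfolding z_def using M y0 by (intro lipschitz_on_concat_max) simp_all
  moreover have "\<exists>v\<in>F (z s). (z has_vector_derivative v) (at s within {0..T + S})"
    \<comment> \<open>The junction and the endpoints join the null set, so that at every other time
      the one-sided derivatives of \<open>x\<close> and \<open>y\<close> are genuine two-sided ones
      and pass to \<open>z\<close>.\<close>
    if s: "s \<in> {0..T + S} - (N \<union> (+) T ` N' \<union> {0, T, T + S})" for s
  proof (cases "s < T")
    case True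
    then obtain v where v: "v \<in> F (x s)" "(x has_vector_derivative v) (at s within {0..T})"
      using N(2)[of s] s by auto
    have "(x has_vector_derivative v) (at s)"
      using v(2) s True by (simp add: at_within_Icc_at)
    then have "(z has_vector_derivative v) (at s)"
      by (rule has_vector_derivative_transform_within_open[of _ _ _ "{..<T}"]) (use True in \<open>auto simp: z_def\<close>)
    then show ?thesis
      using v(1) True by (auto simp: z_def intro: has_vector_derivative_at_within)
  next
    case False
    then have s': "T < s" "s < T + S" "s - T \<notin> N'" using s by force+
    then obtain v where v: "v \<in> F (y (s - T))" "(y has_vector_derivative v) (at (s - T) within {0..S})"
      using N'(2)[of "s - T"] by auto
    have "((\<lambda>s. y (- T + s)) has_vector_derivative v) (at s within {T..T + S})"
      using v(2) by (intro has_vector_derivative_shift_Icc) simp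
    then have "((\<lambda>s. y (s - T)) has_vector_derivative v) (at s)"
      using s' by (simp add: at_within_Icc_at)
    then have "(z has_vector_derivative v) (at s)"
      by (rule has_vector_derivative_transform_within_open[of _ _ _ "{T<..}"]) (use s' in \<open>auto simp: z_def\<close>)
    then show ?thesis
      using v(1) s'(1) by (auto simp: z_def intro: has_vector_derivative_at_within)
  qed
  moreover have "negligible (N \<union> (+) T ` N' \<union> {0, T, T + S})"
    using N(1) N'(1) by (intro negligible_Un negligible_translation) auto
  moreover have "z 0 = x0" using x0 T by (simp add: z_def)
  ultimately show "trajectory F (T + S) x0 z"
    unfolding trajectory_iff by blast
  show "z (T + S) = y S" using y0 S by (auto simp: z_def)
qed

text \<open>The interval \<open>{0..0}\<close> is a null set, so no velocity condition remains. This
  lets a point of the target count as reached in time 0.\<close>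

lemma trajectory_0: "trajectory F 0 x0 (\<lambda>_. x0)"
  unfolding trajectory_iff by (auto intro!: exI[of _ "{0}"] exI[of _ 0] lipschitz_on_constant)

section \<open>Dynamic programming for the minimum time\<close>

lemma min_time_le:
  assumes "trajectory F T x0 x" "x T \<in> K" "0 \<le> T"
  shows "min_time F K x0 \<le> ereal T"
proof (cases "x0 \<in> K")
  case False
  then have "T > 0" using assms by (auto simp: trajectory_def less_le)
  then show ?thesis
    using assms False unfolding min_time_def by (auto intro!: Inf_lower)
qed (use assms in \<open>simp add: min_time_def\<close>)

lemma min_time_less:
  assumes "min_time F K x0 < ereal c"
  obtains T x where "0 \<le> T" "T < c" "trajectory F T x0 x" "x T \<in> K"
proof (cases "x0 \<in> K")
  case True
  then have "0 < c" using assms by (simp add: min_time_def)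
  then show thesis using that[of 0 "\<lambda>_. x0"] trajectory_0 True by simp
next
  case False
  then show thesis
    using assms that unfolding min_time_def by (auto simp: Inf_less_iff) (meson less_imp_le)
qed

text \<open>The infimum at \<open>x t\<close> is only approached: a continuation within
  \<open>e\<close> of it is appended to \<open>x\<close>, and \<open>e\<close> tends to 0.\<close>

lemma min_time_concat:
  assumes x: "trajectory F t x0 x" and t: "0 \<le> t"
  shows "min_time F K x0 \<le> ereal t + min_time F K (x t)"
proof (cases "min_time F K (x t)")
  case (real b)
  have "min_time F K x0 \<le> ereal (t + b) + ereal e" if "e > 0" for e
  proof -
    have "min_time F K (x t) < ereal (b + e)" using real that by simp
    then obtain T y where T: "0 \<le> T" "T < b + e" "trajectory F T (x t) y" "y T \<in> K"
      using min_time_less by blast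
    have "min_time F K x0 \<le> ereal (t + T)"
      using trajectory_concat(2)[OF x T(3) t T(1)] T(1,4) t
      by (intro min_time_le[OF trajectory_concat(1)[OF x T(3) t T(1)]]) auto
    also have "\<dots> \<le> ereal (t + b) + ereal e" using T(2) by simp
    finally show ?thesis .
  qed
  then show ?thesis using real by (auto intro: ereal_le_epsilon2)
qed (use min_time_nonneg[of F K "x t"] in auto)

text \<open>The tail of the arc bounds the minimum time from above; a faster continuation would
  contradict optimality at \<open>x0\<close>.\<close>

lemma min_time_optimal:
  assumes x: "trajectory F T x0 x" "x T \<in> K" and T: "min_time F K x0 = ereal T" and t: "0 \<le> t" "t \<le> T"
  shows "min_time F K (x t) = ereal (T - t)"
proof (rule antisym)
  show "min_time F K (x t) \<le> ereal (T - t)"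
    using x(2) t by (intro min_time_le[OF trajectory_shift[OF x(1) t(1)]]) auto
  have "trajectory F t x0 x"
    using trajectory_shift[OF x(1), of 0 t] t x(1) by (simp add: trajectory_def)
  then have "ereal T \<le> ereal t + min_time F K (x t)"
    using min_time_concat t T by metis
  then show "ereal (T - t) \<le> min_time F K (x t)"
    by (cases "min_time F K (x t)") auto
qed

end

section \<open>Propagation along a Hamiltonian arc\<close>

text \<open>The nondegenerate case. The margin 1 in \<open>x_bound\<close> is the room for backward
  solutions, which stay within distance 1 of \<open>x\<close>.\<close>

locale hamiltonian_arc = semiconvex_inclusion F
  for F :: "'a::euclidean_space \<Rightarrow> 'a set" +
  fixes T :: real and x p :: "real \<Rightarrow> 'a" and r M :: real and N :: "real set"
  assumes T: "0 \<le> T"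
    and x_bound: "\<And>s. s \<in> {0..T} \<Longrightarrow> norm (x s) + 1 < r"
    and x_lip: "M-lipschitz_on {0..T} x"
    and p_lip: "M-lipschitz_on {0..T} p"
    and p_nonzero: "\<And>s. s \<in> {0..T} \<Longrightarrow> p s \<noteq> 0"
    and N: "negligible N"
    and der: "\<And>s. s \<in> {0..T} - N \<Longrightarrow>
      (x has_vector_derivative argmax_ham (x s) (p s)) (at s within {0..T}) \<and>
      (\<exists>p'. (p has_vector_derivative p') (at s within {0..T}) \<and>
        - p' \<in> clarke_gradient (\<lambda>z. max_ham F z (p s)) (x s))"
begin

lemma r_pos: "0 < r"
  using x_bound[of 0] T by (smt (verit) atLeastAtMost_iff norm_ge_zero)

lemma x_in_ball: "s \<in> {0..T} \<Longrightarrow> x s \<in> ball 0 r"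
  using x_bound[of s] by simp

lemma M_nonneg: "0 \<le> M"
  using x_lip by (rule lipschitz_on_nonneg)

lemma p_bounded:
  obtains B where "0 < B" "\<And>s. s \<in> {0..T} \<Longrightarrow> norm (p s) \<le> B"
proof -
  have "bounded (p ` {0..T})"
    by (intro compact_imp_bounded compact_continuous_image lipschitz_on_continuous_on[OF p_lip]) auto
  then show thesis using that unfolding bounded_pos by blast
qed

text \<open>The increment is bounded below by its first-order part \<open>q\<close> minus a
  quadratic error, and \<open>q\<close> has derivative
  \<open>G \<bullet> p' - p' \<bullet> G = 0\<close> at \<open>s\<close>. The bound holds on both
  sides of \<open>s\<close>, which yields both monotonicities.\<close>

lemma max_ham_arc_ge:
  assumes s: "s \<in> {0..T} - N" and e: "0 < e"
  shows "\<exists>d>0. \<forall>u\<in>{0..T}. \<bar>u - s\<bar> < d \<longrightarrow>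
    - e * \<bar>u - s\<bar> \<le> max_ham F (x u) (p u) - max_ham F (x s) (p s)"
proof -
  have sT: "s \<in> {0..T}" using s by simp
  obtain c where c: "c \<ge> 0" "\<And>p. semiconvex_on (ball 0 r) (c * norm p) (\<lambda>x. max_ham F x p)"
    using semiconvex_on_max_ham[OF r_pos] by blast
  obtain L where L: "L > 0" "\<And>p. p \<noteq> 0 \<Longrightarrow> L-lipschitz_on (ball 0 r) (\<lambda>x. argmax_ham x p)"
    using lipschitz_on_argmax_ham[OF r_pos] by blast
  define G where "G = argmax_ham (x s) (p s)"
  obtain p' where x': "(x has_vector_derivative G) (at s within {0..T})"
      and p': "(p has_vector_derivative p') (at s within {0..T})"
      and cl: "- p' \<in> clarke_gradient (\<lambda>z. max_ham F z (p s)) (x s)"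
    using der[OF s] by (auto simp: G_def)
  define q where "q = (\<lambda>u. G \<bullet> (p u - p s) - p' \<bullet> (x u - x s))"
  have "(q has_derivative (\<lambda>h. G \<bullet> (h *\<^sub>R p') - p' \<bullet> (h *\<^sub>R G))) (at s within {0..T})"
    unfolding q_def using x' p' unfolding has_vector_derivative_def
    by (auto intro!: derivative_eq_intros)
  then have "(q has_derivative (\<lambda>h. 0)) (at s within {0..T})"
    by (simp add: inner_commute)
  then obtain d where d: "d > 0" "\<And>u. u \<in> {0..T} \<Longrightarrow> norm (u - s) < d \<Longrightarrow> norm (q u - q s - 0) \<le> e / 2 * norm (u - s)"
    unfolding has_derivative_within_alt using e by (metis half_gt_zero)
  define C where "C = L * M\<^sup>2 + c * norm (p s) / 2 * M\<^sup>2"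
  have C: "C \<ge> 0" using L(1) c(1) by (simp add: C_def)
  have lower: "q u - C * \<bar>u - s\<bar>\<^sup>2 \<le> max_ham F (x u) (p u) - max_ham F (x s) (p s)" if u: "u \<in> {0..T}" for u
  proof -
    define dx dp where "dx = x u - x s" and "dp = p u - p s"
    have dx: "norm dx \<le> M * \<bar>u - s\<bar>" and dp: "norm dp \<le> M * \<bar>u - s\<bar>"
      using lipschitz_onD[OF x_lip u sT] lipschitz_onD[OF p_lip u sT] by (auto simp: dx_def dp_def dist_norm)
    \<comment> \<open>Moving first \<open>x\<close> and then \<open>p\<close> makes the subgradient
      inequality in \<open>p\<close> available at the new point \<open>x u\<close>. Replacing
      \<open>G'\<close> by \<open>G\<close> costs \<open>L |dx| |dp|\<close>, the first summand of
      \<open>C\<close>.\<close>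
    define G' where "G' = argmax_ham (x u) (p s)"
    have "norm (G - G') \<le> L * norm dx"
      using lipschitz_onD[OF L(2)[OF p_nonzero[OF sT]] x_in_ball[OF sT] x_in_ball[OF u]]
      by (simp add: G_def G'_def dx_def dist_norm norm_minus_commute)
    then have "norm (G - G') * norm dp \<le> (L * (M * \<bar>u - s\<bar>)) * (M * \<bar>u - s\<bar>)"
      using dx dp L(1) M_nonneg by (intro mult_mono) (auto intro: order_trans mult_left_mono)
    then have "(G - G') \<bullet> dp \<le> L * M\<^sup>2 * \<bar>u - s\<bar>\<^sup>2"
      using norm_cauchy_schwarz[of "G - G'" dp] by (simp add: power2_eq_square mult_ac)
    moreover have "G' \<bullet> dp \<le> max_ham F (x u) (p u) - max_ham F (x u) (p s)"
      unfolding dp_def by (rule max_ham_diff_le) (simp_all add: G'_def argmax_ham)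
    moreover have "(- p') \<bullet> dx - c * norm (p s) / 2 * (norm dx)\<^sup>2 \<le> max_ham F (x u) (p s) - max_ham F (x s) (p s)"
      using clarke_gradient_semiconvex_on[OF c(2) convex_ball open_ball x_in_ball[OF sT] x_in_ball[OF u] cl]
      by (simp add: dx_def)
    moreover have "c * norm (p s) / 2 * (norm dx)\<^sup>2 \<le> c * norm (p s) / 2 * (M * \<bar>u - s\<bar>)\<^sup>2"
      using dx c(1) by (intro mult_left_mono power_mono) auto
    ultimately show ?thesis
      unfolding q_def C_def dx_def[symmetric] dp_def[symmetric]
      by (simp add: inner_diff_left power_mult_distrib algebra_simps)
  qed
  show ?thesis
  proof (intro exI[of _ "min d (e / (2 * (C + 1)))"] conjI ballI impI)
    show "0 < min d (e / (2 * (C + 1)))" using d(1) e C by simp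
    fix u assume u: "u \<in> {0..T}" "\<bar>u - s\<bar> < min d (e / (2 * (C + 1)))"
    have "C * \<bar>u - s\<bar> \<le> (C + 1) * \<bar>u - s\<bar>"
      by (intro mult_right_mono) auto
    also have "\<dots> \<le> (C + 1) * (e / (2 * (C + 1)))"
      using u(2) C by (intro mult_left_mono) auto
    also have "\<dots> = e / 2" using C by (simp add: divide_simps)
    finally have "C * \<bar>u - s\<bar> * \<bar>u - s\<bar> \<le> e / 2 * \<bar>u - s\<bar>"
      by (rule mult_right_mono) simp
    moreover have "\<bar>q u\<bar> \<le> e / 2 * \<bar>u - s\<bar>"
      using d(2)[OF u(1)] u(2) by (simp add: q_def)
    ultimately show "- e * \<bar>u - s\<bar> \<le> max_ham F (x u) (p u) - max_ham F (x s) (p s)"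
      using lower[OF u(1)] by (simp add: power2_eq_square abs_le_iff)
  qed
qed

lemma max_ham_arc_lipschitz:
  obtains C where "C-lipschitz_on {0..T} (\<lambda>s. max_ham F (x s) (p s))"
proof -
  obtain L where L: "L > 0" "\<And>p. (L * norm p)-lipschitz_on (cball 0 r) (\<lambda>x. max_ham F x p)"
    using lipschitz_on_max_ham[OF compact_cball] by blast
  obtain B where B: "0 < B" "\<And>s. s \<in> {0..T} \<Longrightarrow> norm (p s) \<le> B"
    using p_bounded by blast
  obtain \<gamma> where \<gamma>: "\<gamma> > 0" "\<And>x v. v \<in> F x \<Longrightarrow> norm v \<le> \<gamma> * (1 + norm x)"
    using F_bounded by blast
  have "(L * B * M + \<gamma> * (1 + r) * M)-lipschitz_on {0..T} (\<lambda>s. max_ham F (x s) (p s))"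
  proof (rule lipschitz_onI)
    fix s u assume s: "s \<in> {0..T}" and u: "u \<in> {0..T}"
    have "dist (max_ham F (x s) (p s)) (max_ham F (x u) (p s)) \<le> (L * norm (p s)) * dist (x s) (x u)"
      using x_in_ball[OF s] x_in_ball[OF u] by (intro lipschitz_onD[OF L(2)]) auto
    also have "\<dots> \<le> (L * B) * (M * dist s u)"
      using lipschitz_onD[OF x_lip s u] B(2)[OF s] B(1) L(1) by (intro mult_mono) auto
    finally have 1: "dist (max_ham F (x s) (p s)) (max_ham F (x u) (p s)) \<le> L * B * M * dist s u"
      by simp
    have "norm v \<le> \<gamma> * (1 + r)" if "v \<in> F (x u)" for v
    proof -
      have "norm v \<le> \<gamma> * (1 + norm (x u))" by (rule \<gamma>(2)[OF that])
      also have "\<dots> \<le> \<gamma> * (1 + r)" using x_bound[OF u] \<gamma>(1) by (intro mult_left_mono) auto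
      finally show ?thesis .
    qed
    from lipschitz_onD[OF lipschitz_on_max_ham_right[OF this]]
    have "dist (max_ham F (x u) (p s)) (max_ham F (x u) (p u)) \<le> \<gamma> * (1 + r) * dist (p s) (p u)"
      by simp
    also have "\<dots> \<le> \<gamma> * (1 + r) * (M * dist s u)"
      using lipschitz_onD[OF p_lip s u] \<gamma>(1) r_pos by (intro mult_left_mono) auto
    finally show "dist (max_ham F (x s) (p s)) (max_ham F (x u) (p u))
        \<le> (L * B * M + \<gamma> * (1 + r) * M) * dist s u"
      using 1 dist_triangle[of "max_ham F (x s) (p s)" "max_ham F (x u) (p u)" "max_ham F (x u) (p s)"]
      by (simp add: algebra_simps)
  qed (use L(1) B(1) M_nonneg \<gamma>(1) r_pos in simp)
  then show thesis using that by blast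
qed

lemma max_ham_arc_const:
  assumes t: "t \<in> {0..T}"
  shows "max_ham F (x t) (p t) = max_ham F (x 0) (p 0)"
proof -
  obtain C where C: "C-lipschitz_on {0..T} (\<lambda>s. max_ham F (x s) (p s))"
    using max_ham_arc_lipschitz .
  have lip: "C-lipschitz_on {0..t} (\<lambda>s. max_ham F (x s) (p s))"
    by (rule lipschitz_on_subset[OF C]) (use t in auto)
  have key: "\<exists>d>0. \<forall>u\<in>{0..t}. \<bar>u - s\<bar> < d \<longrightarrow>
      - e * \<bar>u - s\<bar> \<le> max_ham F (x u) (p u) - max_ham F (x s) (p s)"
    if "s \<in> {0..t} - N" "0 < e" for s e
    using max_ham_arc_ge[of s e] that t by fastforce
  have "max_ham F (x 0) (p 0) \<le> max_ham F (x t) (p t)"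
  proof (rule lipschitz_on_right_dini_nonneg[OF lip _ N])
    fix s e :: real assume "s \<in> {0..t} - N" "0 < e"
    then obtain d where "d > 0" "\<forall>u\<in>{0..t}. \<bar>u - s\<bar> < d \<longrightarrow>
      - e * \<bar>u - s\<bar> \<le> max_ham F (x u) (p u) - max_ham F (x s) (p s)"
      using key by blast
    then show "\<exists>d>0. \<forall>u\<in>{0..t}. s < u \<and> u < s + d \<longrightarrow>
        - e * (u - s) \<le> max_ham F (x u) (p u) - max_ham F (x s) (p s)"
      by (intro exI[of _ d]) auto
  qed (use t in simp)
  moreover have "max_ham F (x t) (p t) \<le> max_ham F (x 0) (p 0)"
  proof (rule lipschitz_on_left_dini_nonpos[OF lip _ N])
    fix s e :: real assume "s \<in> {0..t} - N" "0 < e"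
    then obtain d where "d > 0" "\<forall>u\<in>{0..t}. \<bar>u - s\<bar> < d \<longrightarrow>
      - e * \<bar>u - s\<bar> \<le> max_ham F (x u) (p u) - max_ham F (x s) (p s)"
      using key by blast
    then show "\<exists>d>0. \<forall>u\<in>{0..t}. s - d < u \<and> u < s \<longrightarrow>
        - e * (s - u) \<le> max_ham F (x u) (p u) - max_ham F (x s) (p s)"
      by (intro exI[of _ d]) auto
  qed (use t in simp)
  ultimately show ?thesis by simp
qed

lemma argmax_ham_arc_continuous: "continuous_on {0..T} (\<lambda>s. argmax_ham v (p s))"
  unfolding continuous_on_def
proof
  fix s assume s: "s \<in> {0..T}"
  have "isCont (argmax_ham v) (p s)"
    by (rule isCont_argmax_ham[OF gderiv_argmax_ham[OF p_nonzero[OF s]]])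
  moreover have "(p \<longlongrightarrow> p s) (at s within {0..T})"
    using lipschitz_on_continuous_on[OF p_lip] s by (simp add: continuous_on_def)
  ultimately show "((\<lambda>s. argmax_ham v (p s)) \<longlongrightarrow> argmax_ham v (p s)) (at s within {0..T})"
    by (rule isCont_tendsto_compose)
qed

text \<open>The backward solution \<open>w\<close> of \<open>w' = \<nabla>\<^sub>pH(w, p)\<close> through \<open>z\<close>. Since \<open>p \<bullet> \<nabla>\<^sub>pH(w, p) = H(w, p)\<close>, semiconvexity of
  \<open>H(\<cdot>, p)\<close> along \<open>-p' \<in> \<partial>\<^sub>xH(x, p)\<close> bounds the derivative of \<open>p \<bullet> (w - x)\<close> from below by a multiple of
  \<open>|w - x|\<^sup>2\<close>.\<close>

lemma backward_trajectory:
  obtains \<delta> C where "\<delta> > 0" "C \<ge> 0"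
    "\<And>t1 t2 z. 0 \<le> t1 \<Longrightarrow> t1 \<le> t2 \<Longrightarrow> t2 \<le> T \<Longrightarrow> t2 - t1 \<le> \<delta> \<Longrightarrow> norm (z - x t2) < 1 / 2 \<Longrightarrow>
      \<exists>y. trajectory F (t2 - t1) (y 0) y \<and> y (t2 - t1) = z \<and>
        norm (y 0 - x t1) \<le> 2 * norm (z - x t2) \<and>
        p t1 \<bullet> (y 0 - x t1) \<le> p t2 \<bullet> (z - x t2) + C * (norm (z - x t2))\<^sup>2"
proof -
  obtain c where c: "c \<ge> 0" "\<And>p. semiconvex_on (ball 0 r) (c * norm p) (\<lambda>x. max_ham F x p)"
    using semiconvex_on_max_ham[OF r_pos] by blast
  \<comment> \<open>The projection \<open>P\<close> below takes values in the closed ball of radius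
    \<open>r\<close>, whereas (H2) speaks of open balls.\<close>
  have r1: "0 < r + 1" using r_pos by simp
  obtain L where L: "L > 0" "\<And>p. p \<noteq> 0 \<Longrightarrow> L-lipschitz_on (ball 0 (r + 1)) (\<lambda>x. argmax_ham x p)"
    using lipschitz_on_argmax_ham[OF r1] by blast
  obtain B where B: "0 < B" "\<And>s. s \<in> {0..T} \<Longrightarrow> norm (p s) \<le> B"
    using p_bounded by blast
  obtain \<gamma> where \<gamma>: "\<gamma> > 0" "\<And>x v. v \<in> F x \<Longrightarrow> norm v \<le> \<gamma> * (1 + norm x)"
    using F_bounded by blast
  \<comment> \<open>Composing with this projection makes the field bounded and globally Lipschitz
    without changing it on \<open>ball 0 r\<close>, so the backward equation is solvable on the
    whole short interval.\<close>
  define P where "P = closest_point (cball (0 :: 'a) r)"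
  have P_in: "P v \<in> cball 0 r" for v
    unfolding P_def using r_pos by (intro closest_point_in_set) auto
  have P_self: "P v = v" if "v \<in> ball 0 r" for v
    unfolding P_def using that by (intro closest_point_self) auto
  have P_lip: "dist (P v) (P w) \<le> dist v w" for v w
    unfolding P_def using r_pos by (intro closest_point_lipschitz) auto
  define h where "h = (\<lambda>s v. argmax_ham (P v) (p s))"
  have h_lip: "L-lipschitz_on UNIV (h s)" if "s \<in> {0..T}" for s
  proof (rule lipschitz_onI)
    fix v w
    have "P v \<in> ball 0 (r + 1)" "P w \<in> ball 0 (r + 1)" using P_in[of v] P_in[of w] by auto
    then have "dist (h s v) (h s w) \<le> L * dist (P v) (P w)"
      unfolding h_def by (rule lipschitz_onD[OF L(2)[OF p_nonzero[OF that]]])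
    also have "\<dots> \<le> L * dist v w" using L(1) P_lip by (intro mult_left_mono) auto
    finally show "dist (h s v) (h s w) \<le> L * dist v w" .
  qed (use L in simp)
  define A where "A = \<gamma> * (1 + r)"
  have A: "0 \<le> A" using \<gamma>(1) r_pos by (simp add: A_def)
  have h_bound: "norm (h s v) \<le> A" for s v
  proof -
    have "norm (h s v) \<le> \<gamma> * (1 + norm (P v))"
      unfolding h_def by (rule \<gamma>(2)[OF argmax_ham(1)])
    also have "\<dots> \<le> A" unfolding A_def using P_in[of v] \<gamma>(1) by (intro mult_left_mono) auto
    finally show ?thesis .
  qed
  \<comment> \<open>Then \<open>L * \<delta> = 1 / 2\<close>, enough both for the contraction and
    for \<open>norm_le_twice_initial\<close>.\<close>
  define \<delta> where "\<delta> = 1 / (2 * L)"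
  \<comment> \<open>With \<open>|w - x| \<le> 2 * D\<close> and \<open>|p| \<le> B\<close>, the
    semiconvexity error \<open>c |p| / 2 * |w - x|^2\<close> is at most
    \<open>2 * c * B * D^2\<close>. Integrating over a length of at most \<open>T\<close> gives the
    final constant \<open>C * T\<close>.\<close>
  define C where "C = 2 * c * B"
  have C: "0 \<le> C" using c(1) B(1) by (simp add: C_def)
  show thesis
  proof (rule that[of \<delta> "C * T"])
    show "\<delta> > 0" using L(1) by (simp add: \<delta>_def)
    show "C * T \<ge> 0" using C T by simp
    fix t1 t2 z
    assume t: "0 \<le> t1" "t1 \<le> t2" "t2 \<le> T" "t2 - t1 \<le> \<delta>" and z: "norm (z - x t2) < 1 / 2"
    define D where "D = norm (z - x t2)"
    have sub: "{t1..t2} \<subseteq> {0..T}" using t by auto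
    have "L * (t2 - t1) \<le> L * \<delta>" using t(4) L(1) by (intro mult_left_mono) auto
    then have small: "L * (t2 - t1) \<le> 1 / 2" using L(1) by (simp add: \<delta>_def)
    obtain w where w: "w t2 = z"
        "\<And>s. s \<in> {t1..t2} \<Longrightarrow> (w has_vector_derivative h s (w s)) (at s within {t1..t2})"
    proof (rule picard_lindelof[of t2 t1 t2 L h z])
      show "continuous_on {t1..t2} (\<lambda>s. h s v)" for v
        unfolding h_def by (rule continuous_on_subset[OF argmax_ham_arc_continuous sub])
    qed (use t small h_lip sub in auto)
    have w_lip: "A-lipschitz_on {t1..t2} w"
      by (rule bounded_vector_derivative_imp_lipschitz_on[OF w(2) h_bound A])
    have x_lip': "M-lipschitz_on {t1..t2} x" and p_lip': "M-lipschitz_on {t1..t2} p"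
      using x_lip p_lip sub by (auto intro: lipschitz_on_subset)
    have wx_lip: "(A + M)-lipschitz_on {t1..t2} (\<lambda>s. w s - x s)"
      by (rule lipschitz_on_diff[OF w_lip x_lip'])
    have der': "(x has_vector_derivative argmax_ham (x s) (p s)) (at s within {t1..t2}) \<and>
        (\<exists>p'. (p has_vector_derivative p') (at s within {t1..t2}) \<and>
          - p' \<in> clarke_gradient (\<lambda>z. max_ham F z (p s)) (x s))" if "s \<in> {t1..t2} - N" for s
      using der[of s] that sub has_vector_derivative_within_subset[OF _ sub] by blast
    \<comment> \<open>This compares two solutions of the truncated equation, as \<open>x\<close>
      never leaves the ball, so it does not presuppose that \<open>w\<close> stays there. With
      \<open>D < 1 / 2\<close> it then shows that \<open>w\<close> does, and the truncation is
      inactive.\<close>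
    have close: "norm (w s - x s) \<le> 2 * D" if s: "s \<in> {t1..t2}" for s
    proof -
      have "norm (w s - x s) \<le> 2 * norm (w t2 - x t2)"
      proof (rule norm_le_twice_initial[where a = t1 and b = t2 and w = "\<lambda>s. w s - x s",
            OF lipschitz_on_imp_abs_continuous[OF wx_lip] N _ small])
        fix u assume u: "u \<in> {t1..t2} - N"
        then have uT: "u \<in> {0..T}" using sub by auto
        have "h u (x u) = argmax_ham (x u) (p u)"
          using P_self[OF x_in_ball[OF uT]] by (simp add: h_def)
        then have "((\<lambda>s. w s - x s) has_vector_derivative (h u (w u) - h u (x u))) (at u within {t1..t2})"
          using w(2)[of u] der'[OF u] u by (auto intro: has_vector_derivative_diff)
        moreover have "norm (h u (w u) - h u (x u)) \<le> L * norm (w u - x u)"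
          using lipschitz_onD[OF h_lip[OF uT], of "w u" "x u"] by (simp add: dist_norm)
        ultimately show "\<exists>d. norm d \<le> L * norm (w u - x u) \<and>
            ((\<lambda>s. w s - x s) has_vector_derivative d) (at u within {t1..t2})"
          by blast
      qed (use L(1) s in auto)
      then show ?thesis by (simp add: w(1) D_def)
    qed
    have w_in: "w s \<in> ball 0 r" if s: "s \<in> {t1..t2}" for s
    proof -
      have "norm (w s) \<le> norm (x s) + norm (w s - x s)"
        by (metis add.commute diff_add_cancel norm_triangle_ineq)
      also have "\<dots> < r" using x_bound[of s] close[OF s] z sub s by (auto simp: D_def)
      finally show ?thesis by simp
    qed
    \<comment> \<open>The linear term compensates the possible descent of
      \<open>p \<bullet> (w - x)\<close> at rate \<open>C * D\<^sup>2\<close>.\<close>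
    define \<phi> where "\<phi> = (\<lambda>s. p s \<bullet> (w s - x s) + C * D\<^sup>2 * s)"
    have "\<phi> t1 \<le> \<phi> t2"
    proof (rule lipschitz_on_derivative_nonneg[OF _ t(2) N])
      have "(B * (A + M) + M * (2 * D))-lipschitz_on {t1..t2} (\<lambda>s. p s \<bullet> (w s - x s))"
        by (rule lipschitz_on_inner_bounded[OF p_lip' _ wx_lip close]) (use B sub in \<open>auto simp: D_def\<close>)
      moreover have "(C * D\<^sup>2)-lipschitz_on {t1..t2} (\<lambda>s. C * D\<^sup>2 * s)"
      proof (rule lipschitz_onI)
        show "dist (C * D\<^sup>2 * u) (C * D\<^sup>2 * v) \<le> C * D\<^sup>2 * dist u v" for u v :: real
          using C by (simp add: dist_real_def abs_mult flip: right_diff_distrib)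
      qed (use C in simp)
      ultimately show "((B * (A + M) + M * (2 * D)) + C * D\<^sup>2)-lipschitz_on {t1..t2} \<phi>"
        unfolding \<phi>_def by (rule lipschitz_on_add)
      fix s assume s: "s \<in> {t1..t2} - N"
      then have s12: "s \<in> {t1..t2}" and sT: "s \<in> {0..T}" using sub by auto
      obtain p' where x': "(x has_vector_derivative argmax_ham (x s) (p s)) (at s within {t1..t2})"
          and p': "(p has_vector_derivative p') (at s within {t1..t2})"
          and cl: "- p' \<in> clarke_gradient (\<lambda>z. max_ham F z (p s)) (x s)"
        using der'[OF s] by blast
      have w': "(w has_vector_derivative argmax_ham (w s) (p s)) (at s within {t1..t2})"
        using w(2)[OF s12] P_self[OF w_in[OF s12]] by (simp add: h_def)
      define d where "d = p s \<bullet> (argmax_ham (w s) (p s) - argmax_ham (x s) (p s)) + p' \<bullet> (w s - x s) + C * D\<^sup>2"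
      have "(\<phi> has_derivative (\<lambda>h. p s \<bullet> (h *\<^sub>R argmax_ham (w s) (p s) - h *\<^sub>R argmax_ham (x s) (p s))
          + (h *\<^sub>R p') \<bullet> (w s - x s) + C * D\<^sup>2 * h)) (at s within {t1..t2})"
        unfolding \<phi>_def using x' p' w' unfolding has_vector_derivative_def
        by (auto intro!: derivative_eq_intros)
      moreover have "(\<lambda>h. p s \<bullet> (h *\<^sub>R argmax_ham (w s) (p s) - h *\<^sub>R argmax_ham (x s) (p s))
          + (h *\<^sub>R p') \<bullet> (w s - x s) + C * D\<^sup>2 * h) = (*) d"
        by (auto simp: d_def fun_eq_iff algebra_simps inner_diff_right)
      ultimately have "(\<phi> has_real_derivative d) (at s within {t1..t2})"
        by (simp add: has_field_derivative_def)
      moreover have "d \<ge> 0"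
      proof -
        have "(- p') \<bullet> (w s - x s) - c * norm (p s) / 2 * (norm (w s - x s))\<^sup>2
            \<le> max_ham F (w s) (p s) - max_ham F (x s) (p s)"
          by (rule clarke_gradient_semiconvex_on[OF c(2) convex_ball open_ball x_in_ball[OF sT] w_in[OF s12] cl])
        also have "\<dots> = p s \<bullet> (argmax_ham (w s) (p s) - argmax_ham (x s) (p s))"
          by (simp add: inner_diff_right inner_commute[of "p s"] argmax_ham(2))
        finally have "d \<ge> C * D\<^sup>2 - c * norm (p s) / 2 * (norm (w s - x s))\<^sup>2"
          by (simp add: d_def)
        moreover have "c * norm (p s) / 2 * (norm (w s - x s))\<^sup>2 \<le> c * B / 2 * (2 * D)\<^sup>2"
          using c(1) B(2)[OF sT] close[OF s12] B(1) by (intro mult_mono power_mono divide_right_mono) auto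
        moreover have "c * B / 2 * (2 * D)\<^sup>2 = C * D\<^sup>2" by (simp add: C_def power2_eq_square)
        ultimately show ?thesis by linarith
      qed
      ultimately show "\<exists>d\<ge>0. (\<phi> has_real_derivative d) (at s within {t1..t2})" by blast
    qed
    then have "p t1 \<bullet> (w t1 - x t1) \<le> p t2 \<bullet> (z - x t2) + C * D\<^sup>2 * (t2 - t1)"
      by (simp add: \<phi>_def w(1) algebra_simps)
    also have "C * D\<^sup>2 * (t2 - t1) \<le> C * D\<^sup>2 * T"
      using C t by (intro mult_left_mono) auto
    finally have ineq: "p t1 \<bullet> (w t1 - x t1) \<le> p t2 \<bullet> (z - x t2) + C * T * D\<^sup>2"
      by (simp add: mult_ac)
    define y where "y = (\<lambda>s. w (t1 + s))"
    have y': "(y has_vector_derivative argmax_ham (y s) (p (t1 + s))) (at s within {0..t2 - t1})"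
      if s: "s \<in> {0..t2 - t1}" for s
    proof -
      have "t1 + s \<in> {t1..t2}" using s by auto
      then have "(w has_vector_derivative argmax_ham (w (t1 + s)) (p (t1 + s))) (at (t1 + s) within {t1 + 0..t1 + (t2 - t1)})"
        using w(2)[of "t1 + s"] P_self[OF w_in[of "t1 + s"]] by (simp add: h_def)
      then show ?thesis
        unfolding y_def by (rule has_vector_derivative_shift_Icc)
    qed
    have "A-lipschitz_on {0..t2 - t1} y"
    proof (rule lipschitz_onI)
      fix u v assume "u \<in> {0..t2 - t1}" "v \<in> {0..t2 - t1}"
      then show "dist (y u) (y v) \<le> A * dist u v"
        using lipschitz_onD[OF w_lip, of "t1 + u" "t1 + v"] by (simp add: y_def)
    qed (fact A)
    then have "trajectory F (t2 - t1) (y 0) y"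
      unfolding trajectory_iff using y' argmax_ham(1) negligible_empty by blast
    moreover have "y (t2 - t1) = z" "y 0 = w t1" by (simp_all add: y_def w(1))
    ultimately show "\<exists>y. trajectory F (t2 - t1) (y 0) y \<and> y (t2 - t1) = z \<and>
        norm (y 0 - x t1) \<le> 2 * norm (z - x t2) \<and>
        p t1 \<bullet> (y 0 - x t1) \<le> p t2 \<bullet> (z - x t2) + C * T * (norm (z - x t2))\<^sup>2"
      using close[of t1] t ineq by (auto simp: D_def intro!: exI[of _ y])
  qed
qed

end

text \<open>At distance at least \<open>\<eta>\<close> the Cauchy-Schwarz bound
  \<open>|v| |y - x|\<close> is already at most \<open>|v| / \<eta> * |y - x|^2\<close>. Taking the
  maximum with this quotient also makes the constant nonnegative.\<close>

lemma proximal_normal_cone_localI: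
  assumes x: "x \<in> E" and \<eta>: "0 < \<eta>"
    and le: "\<And>y. y \<in> E \<Longrightarrow> norm (y - x) < \<eta> \<Longrightarrow> v \<bullet> (y - x) \<le> \<sigma> * (norm (y - x))\<^sup>2"
  shows "v \<in> proximal_normal_cone E x"
proof -
  define \<rho> where "\<rho> = max \<sigma> (norm v / \<eta>)"
  have "v \<bullet> (y - x) \<le> \<rho> * (norm (y - x))\<^sup>2" if y: "y \<in> E" for y
  proof (cases "norm (y - x) < \<eta>")
    case True
    have "v \<bullet> (y - x) \<le> \<sigma> * (norm (y - x))\<^sup>2" by (rule le[OF y True])
    also have "\<dots> \<le> \<rho> * (norm (y - x))\<^sup>2" by (intro mult_right_mono) (auto simp: \<rho>_def)
    finally show ?thesis .
  next
    case False
    have "v \<bullet> (y - x) \<le> norm v * norm (y - x)" by (rule norm_cauchy_schwarz)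
    also have "\<dots> = norm v / \<eta> * (\<eta> * norm (y - x))" using \<eta> by simp
    also have "\<dots> \<le> norm v / \<eta> * (norm (y - x) * norm (y - x))"
      using False \<eta> by (intro mult_left_mono mult_right_mono) auto
    also have "\<dots> \<le> \<rho> * (norm (y - x))\<^sup>2"
      unfolding power2_eq_square by (intro mult_right_mono) (auto simp: \<rho>_def)
    finally show ?thesis .
  qed
  moreover have "\<rho> \<ge> 0" using \<eta> by (simp add: \<rho>_def le_max_iff_disj)
  ultimately show ?thesis
    unfolding proximal_normal_cone_def using x by blast
qed

lemma (in hamiltonian_arc) proximal_normal_propagates:
  fixes K :: "'a set"
  assumes opt: "\<And>s. s \<in> {0..T} \<Longrightarrow> min_time F K (x s) = ereal (T - s)"
    and start: "(- p 0, h) \<in> proximal_normal_cone (epi (min_time F K)) (x 0, T)"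
    and t: "t \<in> {0..T}"
  shows "(- p t, h) \<in> proximal_normal_cone (epi (min_time F K)) (x t, T - t)"
proof -
  let ?E = "epi (min_time F K)"
  obtain \<delta> C where \<delta>: "\<delta> > 0" and C: "C \<ge> 0"
    and backward: "\<And>t1 t2 z. 0 \<le> t1 \<Longrightarrow> t1 \<le> t2 \<Longrightarrow> t2 \<le> T \<Longrightarrow> t2 - t1 \<le> \<delta> \<Longrightarrow> norm (z - x t2) < 1 / 2 \<Longrightarrow>
      \<exists>y. trajectory F (t2 - t1) (y 0) y \<and> y (t2 - t1) = z \<and>
        norm (y 0 - x t1) \<le> 2 * norm (z - x t2) \<and>
        p t1 \<bullet> (y 0 - x t1) \<le> p t2 \<bullet> (z - x t2) + C * (norm (z - x t2))\<^sup>2"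
    using backward_trajectory by blast
  have step: "(- p t2, h) \<in> proximal_normal_cone ?E (x t2, T - t2)"
    if t: "0 \<le> t1" "t1 \<le> t2" "t2 \<le> T" "t2 - t1 \<le> \<delta>"
      and t1: "(- p t1, h) \<in> proximal_normal_cone ?E (x t1, T - t1)" for t1 t2
  proof -
    obtain \<sigma> where \<sigma>: "\<sigma> \<ge> 0" "\<And>q. q \<in> ?E \<Longrightarrow>
        (- p t1, h) \<bullet> (q - (x t1, T - t1)) \<le> \<sigma> * (norm (q - (x t1, T - t1)))\<^sup>2"
      using t1 unfolding proximal_normal_cone_def by blast
    \<comment> \<open>The radius \<open>1 / 2\<close> is the range of \<open>backward\<close>. The
      factor 4 is the square of the 2 in \<open>|y 0 - x t1| \<le> 2 * D\<close>.\<close>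
    show ?thesis
    proof (rule proximal_normal_cone_localI[of _ _ "1 / 2" _ "C + 4 * \<sigma>"])
      show "(x t2, T - t2) \<in> ?E" using opt[of t2] t by (simp add: epi_def)
      fix q assume q: "q \<in> ?E" "norm (q - (x t2, T - t2)) < 1 / 2"
      obtain z b where zb: "q = (z, b)" by (cases q)
      define D where "D = norm (z - x t2)"
      \<comment> \<open>The vertical offset is the same at both times:
        \<open>(t2 - t1 + b) - (T - t1) = e\<close>. So the term \<open>h * e\<close> passes
        unchanged, and \<open>h\<close> can stay fixed along the arc.\<close>
      define e where "e = b - (T - t2)"
      have norm_q: "(norm (q - (x t2, T - t2)))\<^sup>2 = D\<^sup>2 + e\<^sup>2"
        by (simp add: zb D_def e_def norm_Pair)
      have "D \<le> norm (q - (x t2, T - t2))"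
        unfolding zb D_def by (simp add: norm_fst_le)
      then obtain y where y: "trajectory F (t2 - t1) (y 0) y" "y (t2 - t1) = z"
          "norm (y 0 - x t1) \<le> 2 * D" "p t1 \<bullet> (y 0 - x t1) \<le> p t2 \<bullet> (z - x t2) + C * D\<^sup>2"
        using backward[OF t, of z] q(2) by (auto simp: D_def)
      have "min_time F K (y 0) \<le> ereal (t2 - t1) + min_time F K z"
        using min_time_concat[OF y(1), of K] t(2) y(2) by simp
      also have "\<dots> \<le> ereal (t2 - t1) + ereal b"
        using q(1) by (intro add_left_mono) (simp add: zb epi_def)
      finally have "(y 0, t2 - t1 + b) \<in> ?E"
        using le_less_trans by (force simp: epi_def)
      from \<sigma>(2)[OF this]
      have "- (p t1 \<bullet> (y 0 - x t1)) + h * e \<le> \<sigma> * ((norm (y 0 - x t1))\<^sup>2 + e\<^sup>2)"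
        by (simp add: e_def norm_Pair algebra_simps)
      also have "\<dots> \<le> \<sigma> * ((2 * D)\<^sup>2 + e\<^sup>2)"
        using y(3) \<sigma>(1) by (intro mult_left_mono add_right_mono power_mono) auto
      also have "\<dots> \<le> \<sigma> * (4 * D\<^sup>2 + 4 * e\<^sup>2)"
        using \<sigma>(1) by (intro mult_left_mono) (auto simp: power_mult_distrib)
      finally have "- (p t2 \<bullet> (z - x t2)) + h * e \<le> C * D\<^sup>2 + \<sigma> * (4 * D\<^sup>2 + 4 * e\<^sup>2)"
        using y(4) by linarith
      also have "\<dots> \<le> (C + 4 * \<sigma>) * (D\<^sup>2 + e\<^sup>2)"
        using C by (simp add: algebra_simps)
      finally show "(- p t2, h) \<bullet> (q - (x t2, T - t2)) \<le> (C + 4 * \<sigma>) * (norm (q - (x t2, T - t2)))\<^sup>2"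
        unfolding norm_q by (simp add: zb e_def)
    qed simp
  qed
  \<comment> \<open>The constant goes from \<open>\<sigma>\<close> to
    \<open>C + 4 * \<sigma>\<close> at each step; this is harmless because \<open>\<delta>\<close>
    does not depend on it and \<open>n\<close> is finite.\<close>
  have "(- p t, h) \<in> proximal_normal_cone ?E (x t, T - t)" if "t \<in> {0..T}" "t \<le> real n * \<delta>" for n t
    using that
  proof (induction n arbitrary: t)
    case 0
    then show ?case using start by simp
  next
    case (Suc n)
    show ?case
    proof (rule step[of "max 0 (t - \<delta>)"])
      show "(- p (max 0 (t - \<delta>)), h) \<in> proximal_normal_cone ?E (x (max 0 (t - \<delta>)), T - max 0 (t - \<delta>))"
        using Suc.prems \<delta> by (intro Suc.IH) (auto simp: algebra_simps)
    qed (use Suc.prems \<delta> in auto)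
  qed
  moreover obtain n where "t / \<delta> \<le> real n" using real_arch_simple by blast
  then have "t \<le> real n * \<delta>" using \<delta> by (simp add: field_simps)
  ultimately show ?thesis using t by blast
qed

context semiconvex_inclusion
begin

text \<open>The adjoint inclusion gives \<open>|p'| \<le> L |p|\<close>, so \<open>p\<close> cannot vanish at a single point only.\<close>

lemma hamiltonian_solution_cases:
  assumes T: "0 \<le> T" and x: "trajectory F T x0 x" and p: "abs_continuous 0 T p"
    and sol: "hamiltonian_solution F T x p"
  obtains "\<And>s. s \<in> {0..T} \<Longrightarrow> p s = 0" | r M N where "hamiltonian_arc F T x p r M N"
proof -
  obtain Mx where Mx: "Mx-lipschitz_on {0..T} x"
    using x unfolding trajectory_iff by blast
  have "bounded (x ` {0..T})" "bounded (p ` {0..T})"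
    using lipschitz_on_continuous_on[OF Mx] abs_continuous_imp_continuous_on[OF p]
    by (auto intro!: compact_imp_bounded compact_continuous_image)
  then obtain R B where R: "0 < R" "\<And>s. s \<in> {0..T} \<Longrightarrow> norm (x s) \<le> R"
    and B: "0 < B" "\<And>s. s \<in> {0..T} \<Longrightarrow> norm (p s) \<le> B"
    unfolding bounded_pos by (metis imageI)
  define r where "r = R + 2"
  have r: "0 < r" using R(1) by (simp add: r_def)
  obtain c where c: "c \<ge> 0" "\<And>p. semiconvex_on (ball 0 r) (c * norm p) (\<lambda>x. max_ham F x p)"
    using semiconvex_on_max_ham[OF r] by blast
  obtain L where L: "L > 0" "\<And>p. (L * norm p)-lipschitz_on (cball 0 r) (\<lambda>x. max_ham F x p)"
    using lipschitz_on_max_ham[OF compact_cball] by blast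
  obtain N where N: "negligible N"
    and der: "\<And>s. s \<in> {0..T} - N \<Longrightarrow> \<exists>x' p'. (x has_vector_derivative x') (at s within {0..T}) \<and>
              (p has_vector_derivative p') (at s within {0..T}) \<and>
              GDERIV (max_ham F (x s)) (p s) :> x' \<and>
              - p' \<in> clarke_gradient (\<lambda>z. max_ham F z (p s)) (x s)"
    using sol unfolding hamiltonian_solution_def by (auto simp: AE_lebesgue_on_iff_negligible)
  have p'_le: "norm p' \<le> L * norm (p s)"
    if "s \<in> {0..T}" "- p' \<in> clarke_gradient (\<lambda>z. max_ham F z (p s)) (x s)" for s p'
  proof -
    have "(L * norm (p s))-lipschitz_on (ball 0 r) (\<lambda>x. max_ham F x (p s))"
      by (rule lipschitz_on_subset[OF L(2)]) auto
    then have "norm (- p') \<le> L * norm (p s)"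
      using R(2)[OF that(1)] that(2)
      by (intro clarke_gradient_norm_le[OF c(2) convex_ball open_ball, of _ _ "x s"]) (auto simp: r_def)
    then show ?thesis by simp
  qed
  have p_der: "\<exists>d. norm d \<le> L * norm (p s) \<and> (p has_vector_derivative d) (at s within {0..T})"
    if s: "s \<in> {0..T} - N" for s
    using der[OF s] p'_le s by blast
  have "(L * B)-lipschitz_on {0..T} p"
  proof (rule abs_continuous_imp_lipschitz_on[OF p _ N])
    fix s assume s: "s \<in> {0..T} - N"
    have "L * norm (p s) \<le> L * B" using B(2)[of s] s L(1) by (intro mult_left_mono) auto
    then show "\<exists>d. norm d \<le> L * B \<and> (p has_vector_derivative d) (at s within {0..T})"
      using p_der[OF s] order_trans by blast
  qed (use L(1) B(1) in simp)
  then have p_lip: "(max Mx (L * B))-lipschitz_on {0..T} p"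
    by (rule lipschitz_on_le) simp
  have x_lip: "(max Mx (L * B))-lipschitz_on {0..T} x"
    using Mx by (rule lipschitz_on_le) simp
  show thesis
  proof (cases "\<exists>s\<in>{0..T}. p s = 0")
    case True
    then have "p s = 0" if "s \<in> {0..T}" for s
      using vanishes_everywhere[OF p N L(1) p_der _ _ that] by blast
    then show thesis by (rule that(1))
  next
    case False
    have "hamiltonian_arc F T x p r (max Mx (L * B)) N"
    proof
      fix s assume s: "s \<in> {0..T} - N"
      show "(x has_vector_derivative argmax_ham (x s) (p s)) (at s within {0..T}) \<and>
        (\<exists>p'. (p has_vector_derivative p') (at s within {0..T}) \<and>
          - p' \<in> clarke_gradient (\<lambda>z. max_ham F z (p s)) (x s))"
        using der[OF s] gderiv_max_ham_eq_argmax by metis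
    next
      fix s assume "s \<in> {0..T}"
      then show "norm (x s) + 1 < r" using R(2)[of s] by (simp add: r_def)
    qed (use T x_lip p_lip N False in auto)
    then show thesis by (rule that(2))
  qed
qed

end

section \<open>Combining the degenerate and the nondegenerate adjoint arc\<close>

theorem theorem4p5:
  fixes F :: "real ^ 'n \<Rightarrow> (real ^ 'n) set"
    and K :: "(real ^ 'n) set"
    and x0 :: "real ^ 'n"
    and x p :: "real \<Rightarrow> real ^ 'n"
  defines "\<tau> \<equiv> \<lambda>y. real_of_ereal (min_time F K y)"
  assumes "assumption_F F"
    and "assumption_H F"
    and "closed K"
    and "x0 \<in> controllable_set F K - K"
    and "optimal_trajectory F K x0 x"
    and "abs_continuous 0 (\<tau> x0) p"
    and "hamiltonian_solution F (\<tau> x0) x p"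
    and "(- p 0, min_ham F x0 (- p 0)) \<in> proximal_normal_cone (epi (min_time F K)) (x0, \<tau> x0)"
  shows "(\<forall>t\<in>{0..<\<tau> x0}.
            (- p t, min_ham F (x t) (- p t))
              \<in> proximal_normal_cone (epi (min_time F K)) (x t, \<tau> (x t)))
       \<and> (\<forall>t\<in>{0..\<tau> x0}. min_ham F (x t) (- p t) = min_ham F x0 (- p 0))"
proof -
  interpret semiconvex_inclusion F
    by unfold_locales (fact assms)+
  define T where "T = \<tau> x0"
  have "min_time F K x0 < \<infinity>" and "0 \<le> min_time F K x0"
    using assms(5) min_time_nonneg by (auto simp: controllable_set_def)
  then have T: "min_time F K x0 = ereal T" "0 \<le> T"
    by (cases "min_time F K x0"; simp add: T_def \<tau>_def)+
  have x: "trajectory F T x0 x" "x T \<in> K"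
    using assms(6) by (simp_all add: optimal_trajectory_def Let_def T_def \<tau>_def)
  then have x_0: "x 0 = x0" by (simp add: trajectory_def)
  have opt: "min_time F K (x s) = ereal (T - s)" if "s \<in> {0..T}" for s
    using min_time_optimal[OF x T(1)] that by simp
  then have \<tau>: "\<tau> (x s) = T - s" if "s \<in> {0..T}" for s
    using that by (simp add: \<tau>_def)
  have p: "abs_continuous 0 T p" and sol: "hamiltonian_solution F T x p"
    using assms(7,8) by (simp_all add: T_def)
  show ?thesis
  proof (rule hamiltonian_solution_cases[OF T(2) x(1) p sol])
    assume zero: "\<And>s. s \<in> {0..T} \<Longrightarrow> p s = 0"
    have "min_ham F y 0 = 0" for y
      using min_ham_minus[of y 0] by simp
    \<comment> \<open>The zero vector is a normal only at points of the epigraph, since the cone is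
      empty elsewhere; \<open>opt\<close> supplies the membership.\<close>
    moreover have "(0, 0) \<in> proximal_normal_cone (epi (min_time F K)) (x t, \<tau> (x t))" if "t \<in> {0..T}" for t
      using opt[OF that] \<tau>[OF that] by (auto simp: proximal_normal_cone_def epi_def simp flip: zero_prod_def)
    ultimately show ?thesis
      using zero T(2) by (auto simp flip: T_def)
  next
    fix r M N assume "hamiltonian_arc F T x p r M N"
    then interpret hamiltonian_arc F T x p r M N .
    have const: "min_ham F (x t) (- p t) = min_ham F x0 (- p 0)" if "t \<in> {0..T}" for t
      using max_ham_arc_const[OF that] by (simp add: min_ham_minus x_0)
    \<comment> \<open>Propagation keeps the vertical component at its initial value;
      \<open>const\<close> identifies it with the Hamiltonian at time \<open>t\<close>.\<close>
    have "(- p t, min_ham F x0 (- p 0)) \<in> proximal_normal_cone (epi (min_time F K)) (x t, T - t)"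
      if "t \<in> {0..T}" for t
      by (rule proximal_normal_propagates[OF opt _ that]) (use assms(9) in \<open>simp_all add: x_0 T_def\<close>)
    then show ?thesis
      using const \<tau> by (simp flip: T_def)
  qed
qed

end
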